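(* In the noiseless model, for every $r\ge 1$ there is a randomized algorithm for PARTITION on $n$ elements with round complexity $2$ and query complexity $(r+1)n$ which outputs a partition such that, for all $c$ and all $\varepsilon>0$: (i) the expected $c$-weighted error is at most $(8rn^{(r+1)/(2r+1)+\varepsilon})^{c+1}$; (ii) the $c$-weighted error is at most $(8rn^{(r+1)/(2r+1)+\varepsilon})^{c+1}$ with probability at least $1-re^{-n^{\Omega(\varepsilon)}}$. Moreover, setting $r=\log n$ and $\varepsilon$ such that $n^{\varepsilon}=8\log^3 n$, one gets an algorithm with round complexity $2$ and query complexity $n\log n+n$ that outputs a partition with $c$-weighted error $O((\sqrt n\log^4 n)^{c+1})$ with probability $1-O(\log n/n^2)$.
   Context: Setting. The input is a set of $n$ elements with an unknown total order, presented in uniformly random order (the elements are a priori indistinguishable). For $i\in\{1,\dots,n\}$ the $i$-th smallest element is denoted $i$. PARTITION (with cutoff the median, $k=n/2$): output a partition of the elements into a set $A$ (accepted, meant to be the elements above the median) and a set $R$ (rejected, meant to be the elements below the median). For a constant $c\ge 0$, the $c$-weighted error of $A\sqcup R$ is $\sum_{i>n/2} I(i\in R)\,|i-n/2|^c+\sum_{i<n/2} I(i\in A)\,|i-n/2|^c$, where $I$ is the indicator function (so $c=0$ counts mistakes). Algorithms access the order only through pairwise comparison queries. Query complexity is the total number of comparisons; round complexity is the number of adaptive rounds (within a round all queries are chosen before any answer of that round is seen). Noiseless model: every comparison returns the correct answer. Asymptotics are as $n\to\infty$; $r$ and $\varepsilon$ may be constants or functions of $n$. Probabilities and expectations are over the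 random input order and the algorithm's randomness. *)

theory Defs
  imports "HOL-Probability.Probability" "HOL-Combinatorics.Permutations"
    "HOL-Library.Landau_Symbols"
begin

text \<open>
  An input on \<open>n\<close> elements is a permutation \<open>\<pi>\<close> of \<open>{1..n}\<close>: the algorithm refers to
  the elements by their positions \<open>x \<in> {1..n}\<close>, and \<open>\<pi> x\<close> is the (hidden) rank of the
  element in position \<open>x\<close>, so that rank \<open>i\<close> is the \<open>i\<close>-th smallest element.

  A deterministic algorithm is a comparison tree with batched queries.  In
  \<open>Round qs k\<close> the whole batch \<open>qs\<close> is fixed before any of its answers is seen; the
  computation then continues with \<open>k\<close> applied to the list of answers.  A leaf
  \<open>Output A R\<close> accepts the positions in \<open>A\<close> and rejects those in \<open>R\<close>.
\<close>

datatype comparison_tree =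
    Output "nat set" "nat set"
  | Round "(nat \<times> nat) list" "bool list \<Rightarrow> comparison_tree"

definition answers :: "(nat \<Rightarrow> nat) \<Rightarrow> (nat \<times> nat) list \<Rightarrow> bool list" where
  "answers \<pi> qs = map (\<lambda>(x, y). \<pi> x < \<pi> y) qs"

primrec run :: "(nat \<Rightarrow> nat) \<Rightarrow> comparison_tree \<Rightarrow> nat set \<times> nat set" where
  "run \<pi> (Output A R) = (A, R)"
| "run \<pi> (Round qs k) = run \<pi> (k (answers \<pi> qs))"

primrec rounds :: "(nat \<Rightarrow> nat) \<Rightarrow> comparison_tree \<Rightarrow> nat" where
  "rounds \<pi> (Output A R) = 0"
| "rounds \<pi> (Round qs k) = Suc (rounds \<pi> (k (answers \<pi> qs)))"

primrec queries :: "(nat \<Rightarrow> nat) \<Rightarrow> comparison_tree \<Rightarrow> nat" where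
  "queries \<pi> (Output A R) = 0"
| "queries \<pi> (Round qs k) = length qs + queries \<pi> (k (answers \<pi> qs))"

primrec partition_tree :: "nat \<Rightarrow> comparison_tree \<Rightarrow> bool" where
  "partition_tree n (Output A R) \<longleftrightarrow> A \<union> R = {1..n} \<and> A \<inter> R = {}"
| "partition_tree n (Round qs k) \<longleftrightarrow>
     set qs \<subseteq> {1..n} \<times> {1..n} \<and>
     (\<forall>ans. length ans = length qs \<longrightarrow> partition_tree n (k ans))"

text \<open>
  A randomized algorithm is a probability distribution on deterministic ones.  The
  round and query bounds are worst-case: they hold for every input order and every
  outcome of the algorithm's randomness.
\<close>

type_synonym randomized_algorithm = "comparison_tree pmf"

definition partition_algorithm :: "nat \<Rightarrow> nat \<Rightarrow> real \<Rightarrow> randomized_algorithm \<Rightarrow> bool" where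
  "partition_algorithm n d q M \<longleftrightarrow>
     (\<forall>t \<in> set_pmf M. partition_tree n t \<and>
        (\<forall>\<pi>. \<pi> permutes {1..n} \<longrightarrow> rounds \<pi> t \<le> d \<and> real (queries \<pi> t) \<le> q))"

text \<open>
  The partition produced on a uniformly random input order, with the positions of the
  accepted and of the rejected elements translated into ranks.
\<close>

definition outcome :: "nat \<Rightarrow> randomized_algorithm \<Rightarrow> (nat set \<times> nat set) pmf" where
  "outcome n M =
     map_pmf (\<lambda>(\<pi>, t). map_prod (image \<pi>) (image \<pi>) (run \<pi> t))
       (pair_pmf (pmf_of_set {\<pi>. \<pi> permutes {1..n}}) M)"

definition weighted_error :: "nat \<Rightarrow> real \<Rightarrow> nat set \<times> nat set \<Rightarrow> real" where
  "weighted_error n c = (\<lambda>(A, R).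
     (\<Sum>i \<in> {i \<in> {1..n}. real i > real n / 2}. indicator R i * \<bar>real i - real n / 2\<bar> powr c) +
     (\<Sum>i \<in> {i \<in> {1..n}. real i < real n / 2}. indicator A i * \<bar>real i - real n / 2\<bar> powr c))"

definition expected_error :: "nat \<Rightarrow> real \<Rightarrow> randomized_algorithm \<Rightarrow> real" where
  "expected_error n c M = measure_pmf.expectation (outcome n M) (weighted_error n c)"

definition prob_error_le :: "nat \<Rightarrow> real \<Rightarrow> randomized_algorithm \<Rightarrow> real \<Rightarrow> real" where
  "prob_error_le n c M b = measure_pmf.prob (outcome n M) {P. weighted_error n c P \<le> b}"

definition error_bound :: "nat \<Rightarrow> real \<Rightarrow> nat \<Rightarrow> real \<Rightarrow> real" where
  "error_bound n c r \<epsilon> =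
     (8 * real r * real n powr ((real r + 1) / (2 * real r + 1) + \<epsilon>)) powr (c + 1)"

end

theory Submission
  imports Defs "HOL-Real_Asymp.Real_Asymp"
begin

text \<open>
  Let \<open>P\<^sub>1 \<subseteq> P\<^sub>2 \<subseteq> \<dots>\<close> be sets of candidates of geometrically growing size \<open>\<rho>\<^sup>k\<close>, and
  compare all of \<open>P\<^sub>k\<close> with a sample \<open>Q\<^sub>k\<close> of size about \<open>n / \<rho>\<^sup>k\<close>.  From the pivot \<open>x\<close>
  of level \<open>k - 1\<close> the ranks of the candidates of level \<open>k\<close> are estimated by counting
  the elements of \<open>Q\<^sub>k\<close> between them and \<open>x\<close>, and the candidate with estimate closest to
  the median becomes the next pivot.  The window around the median shrinks by \<open>\<rho>\<close> per
  level while the sample fluctuations inside it stay of order \<open>\<surd>(\<rho> n)\<close>.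

  The threshold for \<open>n\<close> precedes the quantifier on \<open>\<epsilon>\<close>, so the bounds are needed with the
  exponent \<open>(r + 1) / (2r + 1)\<close> itself and without room for logarithmic factors.  Hence
  \<open>8r\<close> levels are used instead of \<open>r\<close>, which gains a factor \<open>n\<close> to the power \<open>-\<Omega>(1/r)\<close>; for
  \<open>r\<close> of order close to \<open>ln n\<close>, where this is too little, the second round compares
  all elements with about \<open>r / 2\<close> pivots consecutive in a finer candidate set.  It reveals
  their exact ranks, and splitting at the best one gains the missing factor.  Values of
  \<open>r\<close> beyond \<open>ln n\<close> no longer improve the exponent noticeably, so \<open>r\<close> is capped there.
\<close>

section \<open>Hits of a fixed set by a random permutation\<close>

text \<open>The tree itself is deterministic: prefixes \<open>{1..p k}\<close> and
  \<open>{1..q k}\<close> of the positions serve as candidates and samples, and the random input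
  order supplies all the randomness. Hence each elementary failure event concerns one prefix and one
  fixed set of ranks, and a union bound over all ranks in a window centred at the median covers
  whichever pivot gets chosen. Within one prefix, sampling without replacement is dominated by the
  binomial law.

  A level adds at most \<open>2 * E\<close> to the error of the estimates, so with \<open>E\<close>
  of order \<open>sqrt (l * n)\<close> and up to \<open>8 * l\<close> levels the chain cannot go
  below windows of size about \<open>sqrt n * l powr (3/2)\<close>; this fixes the total shrinkage.

  The parameter \<open>s\<close> trades accuracy against a failure probability of order
  \<open>R * exp (- s)\<close>. It occurs only in the analysis: one tree serves all \<epsilon> and
  all \<open>c\<close>, and each bound picks its own \<open>s\<close>.\<close>

lemma card_permutes_image_swap:
  assumes "x \<in> A" "y \<in> A" "x \<notin> S" "y \<notin> S"
  shows "card {\<pi>. \<pi> permutes A \<and> \<pi> ` insert x S \<subseteq> M}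
       = card {\<pi>. \<pi> permutes A \<and> \<pi> ` insert y S \<subseteq> M}"
proof (rule bij_betw_same_card)
  let ?t = "Transposition.transpose x y"
  have t: "?t permutes A" using assms by (simp add: permutes_swap_id)
  have im: "?t ` S = S"
    using assms by (auto simp: Transposition.transpose_def image_iff)
  have 1: "\<pi> \<circ> ?t \<circ> ?t = \<pi>" for \<pi> :: "'a \<Rightarrow> 'a"
    by (simp add: comp_assoc)
  have img: "(\<pi> \<circ> ?t) ` insert y S = \<pi> ` insert x S" "(\<pi> \<circ> ?t) ` insert x S = \<pi> ` insert y S" for \<pi> :: "'a \<Rightarrow> 'a"
    unfolding image_comp[symmetric] image_insert im by simp_all
  let ?A = "\<lambda>x. {\<pi>. \<pi> permutes A \<and> \<pi> ` insert x S \<subseteq> M}"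
  have 2: "\<pi> \<circ> ?t \<in> ?A y" if "\<pi> \<in> ?A x" for \<pi>
    using that unfolding mem_Collect_eq img by (blast intro: permutes_compose[OF t])
  have 3: "\<pi> \<circ> ?t \<in> ?A x" if "\<pi> \<in> ?A y" for \<pi>
    using that unfolding mem_Collect_eq img by (blast intro: permutes_compose[OF t])
  show "bij_betw (\<lambda>\<pi>. \<pi> \<circ> ?t) (?A x) (?A y)"
  proof (rule bij_betw_byWitness[where f' = "\<lambda>\<pi>. \<pi> \<circ> ?t"])
    show "(\<lambda>\<pi>. \<pi> \<circ> ?t) ` ?A x \<subseteq> ?A y" using 2 by (rule image_subsetI)
    show "(\<lambda>\<pi>. \<pi> \<circ> ?t) ` ?A y \<subseteq> ?A x" using 3 by (rule image_subsetI)
  qed (use 1 in blast)+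
qed

text \<open>Double counting of pairs of an order sending S into M and a point \<open>y\<close>
  outside S that it also sends into M. By the swap symmetry every \<open>y\<close> contributes
  equally, and each such order leaves \<open>card M - card S\<close> values of M for these
  points.\<close>

lemma card_permutes_image_insert:
  assumes A: "finite A" "M \<subseteq> A" and S: "S \<subseteq> A" and x: "x \<in> A" "x \<notin> S"
  shows "(card A - card S) * card {\<pi>. \<pi> permutes A \<and> \<pi> ` insert x S \<subseteq> M}
       = (card M - card S) * card {\<pi>. \<pi> permutes A \<and> \<pi> ` S \<subseteq> M}"
proof -
  let ?P = "{\<pi>. \<pi> permutes A \<and> \<pi> ` S \<subseteq> M}"
  have fin: "finite ?P" using finite_permutations[OF A(1)] by (rule rev_finite_subset) auto
  have fS: "finite S" using A S finite_subset by blast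
  have "(card A - card S) * card {\<pi>. \<pi> permutes A \<and> \<pi> ` insert x S \<subseteq> M}
      = (\<Sum>y\<in>A - S. card {\<pi>. \<pi> permutes A \<and> \<pi> ` insert y S \<subseteq> M})"
    using card_permutes_image_swap[OF x(1) _ x(2), of _ M] S fS
    by (subst sum.cong[OF refl, where h = "\<lambda>_. card {\<pi>. \<pi> permutes A \<and> \<pi> ` insert x S \<subseteq> M}"])
       (auto simp: card_Diff_subset simp del: image_insert)
  also have "\<dots> = (\<Sum>y\<in>A - S. \<Sum>\<pi>\<in>?P. if \<pi> y \<in> M then 1 else 0)"
  proof (rule sum.cong[OF refl])
    fix y assume "y \<in> A - S"
    have "{\<pi>. \<pi> permutes A \<and> \<pi> ` insert y S \<subseteq> M} = {\<pi> \<in> ?P. \<pi> y \<in> M}" by auto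
    then show "card {\<pi>. \<pi> permutes A \<and> \<pi> ` insert y S \<subseteq> M} = (\<Sum>\<pi>\<in>?P. if \<pi> y \<in> M then 1 else 0)"
      by (simp only: sum.If_cases[OF fin]) (simp add: Int_def fin)
  qed
  also have "\<dots> = (\<Sum>\<pi>\<in>?P. \<Sum>y\<in>A - S. if \<pi> y \<in> M then 1 else 0)"
    by (rule sum.swap)
  also have "\<dots> = (\<Sum>\<pi>\<in>?P. card M - card S)"
  proof (rule sum.cong[OF refl])
    fix \<pi> assume p: "\<pi> \<in> ?P"
    then have bij: "bij_betw \<pi> A A" by (simp add: permutes_imp_bij)
    have inj: "inj_on \<pi> X" for X using p permutes_inj inj_on_subset by blast
    have "\<pi> ` {y \<in> A - S. \<pi> y \<in> M} = M - \<pi> ` S"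
    proof -
      have "\<pi> ` {y \<in> A. \<pi> y \<in> M} = M" using bij A(2) by (auto simp: bij_betw_def)
      moreover have "{y \<in> A - S. \<pi> y \<in> M} = {y \<in> A. \<pi> y \<in> M} - S" by auto
      ultimately show ?thesis using inj[of UNIV] by (simp add: image_set_diff)
    qed
    then have "card {y \<in> A - S. \<pi> y \<in> M} = card M - card S"
      using card_image[OF inj, of "{y \<in> A - S. \<pi> y \<in> M}"] card_image[OF inj, of S] p fS
      by (simp add: card_Diff_subset)
    then show "(\<Sum>y\<in>A - S. if \<pi> y \<in> M then 1 else 0) = card M - card S"
      using A(1) by (subst sum.If_cases) (auto simp: Int_def)
  qed
  also have "\<dots> = (card M - card S) * card ?P" by simp
  finally show ?thesis .
qed

text \<open>Each point of S contributes a factor \<open>(card M - s) / (card A - s)\<close>. As M is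
  contained in A, this is at most the density \<open>card M / card A\<close>: drawing without
  replacement makes joint hits no likelier than independent draws.\<close>

lemma card_permutes_image_le:
  assumes A: "finite A" "M \<subseteq> A" and S: "S \<subseteq> A"
  shows "real (card {\<pi>. \<pi> permutes A \<and> \<pi> ` S \<subseteq> M})
    \<le> fact (card A) * (real (card M) / real (card A)) ^ card S"
proof -
  have "finite S" using A S finite_subset by blast
  then show ?thesis using S
  proof (induction S)
    case empty
    then show ?case by (simp add: card_permutations[OF refl A(1)])
  next
    case (insert x S)
    let ?m = "real (card M)" and ?n = "real (card A)" and ?s = "card S"
    let ?N = "\<lambda>S. real (card {\<pi>. \<pi> permutes A \<and> \<pi> ` S \<subseteq> M})"
    have mn: "card M \<le> card A" using A card_mono by blast
    have "card (insert x S) \<le> card A" using insert A card_mono by blast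
    then have sn: "?s < card A" using insert by simp
    have eq: "real (card A - ?s) * ?N (insert x S) = real (card M - ?s) * ?N S"
      unfolding of_nat_mult[symmetric]
      by (rule arg_cong[where f = real], rule card_permutes_image_insert[OF A]) (use insert in auto)
    have "real (card M - ?s) * ?n \<le> ?m * real (card A - ?s)"
    proof (cases "?s \<le> card M")
      case True
      then show ?thesis using sn mn by (simp add: of_nat_diff algebra_simps mult_right_mono)
    qed simp
    then have "real (card M - ?s) / real (card A - ?s) \<le> ?m / ?n"
      using sn by (simp add: field_simps)
    then have "?N (insert x S) \<le> ?m / ?n * ?N S"
    proof -
      assume *: "real (card M - ?s) / real (card A - ?s) \<le> ?m / ?n"
      have "?N (insert x S) = real (card M - ?s) / real (card A - ?s) * ?N S"
        using eq sn by (simp add: field_simps)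
      also have "\<dots> \<le> ?m / ?n * ?N S" using * by (rule mult_right_mono) simp
      finally show ?thesis .
    qed
    also have "\<dots> \<le> ?m / ?n * (fact (card A) * (?m / ?n) ^ ?s)"
      using insert by (intro mult_left_mono) auto
    finally show ?case using insert by (simp add: mult_ac)
  qed
qed

section \<open>Exponential tail bounds under a uniformly random order\<close>

definition random_order :: "nat \<Rightarrow> (nat \<Rightarrow> nat) pmf" where
  "random_order n = pmf_of_set {\<pi>. \<pi> permutes {1..n}}"

lemma permutations_1_n:
  "finite {\<pi>. \<pi> permutes {1..n}}" "{\<pi>. \<pi> permutes {1..n}} \<noteq> {}"
  "card {\<pi>. \<pi> permutes {1..n}} = fact n"
  by (simp add: finite_permutations) (use permutes_id in blast, simp add: card_permutations)

lemma prob_random_order: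
  "measure_pmf.prob (random_order n) X = real (card {\<pi>. \<pi> permutes {1..n} \<and> \<pi> \<in> X}) / fact n"
  unfolding random_order_def
  by (subst measure_pmf_of_set) (use permutations_1_n in \<open>auto simp: Int_def\<close>)

lemma set_random_order: "set_pmf (random_order n) = {\<pi>. \<pi> permutes {1..n}}"
  unfolding random_order_def using permutations_1_n by (intro set_pmf_of_set) auto

lemma finite_set_random_order: "finite (set_pmf (random_order n))"
  by (simp add: set_random_order finite_permutations)

lemma integrable_random_order: "integrable (measure_pmf (random_order n)) (f :: _ \<Rightarrow> real)"
  by (intro integrable_measure_pmf_finite finite_set_random_order)

lemma prob_image_subset_le:
  assumes "M \<subseteq> {1..n}" "S \<subseteq> {1..n}"
  shows "measure_pmf.prob (random_order n) {\<pi>. \<pi> ` S \<subseteq> M} \<le> (real (card M) / real n) ^ card S"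
  using card_permutes_image_le[of "{1..n}" M S] assms
  by (simp add: prob_random_order divide_le_eq mult.commute)

definition hits :: "(nat \<Rightarrow> nat) \<Rightarrow> nat set \<Rightarrow> nat set \<Rightarrow> nat" where
  "hits \<pi> S M = card {x \<in> S. \<pi> x \<in> M}"

text \<open>This replaces independence. The exponential is the product over S of 1 plus
  \<open>exp \<theta> - 1\<close> at each hit; expanded over subsets T of S, its expectation
  involves only the probabilities that T is sent into M. For \<open>0 \<le> \<theta>\<close> all
  coefficients are nonnegative, so the product bound on these probabilities yields the binomial
  moment generating function.\<close>

lemma mgf_hits:
  assumes M: "M \<subseteq> {1..n}" and S: "S \<subseteq> {1..n}" and l: "0 \<le> \<theta>"
  shows "measure_pmf.expectation (random_order n) (\<lambda>\<pi>. exp (\<theta> * real (hits \<pi> S M)))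
    \<le> (1 + (exp \<theta> - 1) * (real (card M) / real n)) ^ card S"
proof -
  let ?d = "exp \<theta> - 1" and ?\<mu> = "real (card M) / real n"
  have fS: "finite S" using S finite_subset by blast
  have "exp (\<theta> * real (hits \<pi> S M)) = (\<Sum>T\<in>Pow S. ?d ^ card T * indicator {\<pi>. \<pi> ` T \<subseteq> M} \<pi>)" for \<pi>
  proof -
    have "exp (\<theta> * real (hits \<pi> S M)) = (\<Prod>x\<in>{x \<in> S. \<pi> x \<in> M}. exp \<theta>)"
      by (simp add: hits_def exp_of_nat_mult[symmetric] mult.commute)
    also have "\<dots> = (\<Prod>x\<in>S. (if \<pi> x \<in> M then ?d else 0) + 1)"
      using fS by (intro prod.mono_neutral_cong_left) auto
    also have "\<dots> = (\<Sum>T\<in>Pow S. (\<Prod>x\<in>T. if \<pi> x \<in> M then ?d else 0) * (\<Prod>x\<in>S-T. 1))"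
      by (rule prod_add[OF fS])
    also have "\<dots> = (\<Sum>T\<in>Pow S. ?d ^ card T * indicator {\<pi>. \<pi> ` T \<subseteq> M} \<pi>)"
    proof (rule sum.cong[OF refl])
      fix T assume "T \<in> Pow S"
      then have fT: "finite T" using fS finite_subset by blast
      show "(\<Prod>x\<in>T. if \<pi> x \<in> M then ?d else 0) * (\<Prod>x\<in>S-T. 1)
        = ?d ^ card T * indicator {\<pi>. \<pi> ` T \<subseteq> M} \<pi>"
      proof (cases "\<pi> ` T \<subseteq> M")
        case True
        then have "(\<Prod>x\<in>T. if \<pi> x \<in> M then ?d else 0) = (\<Prod>x\<in>T. ?d)"
          by (intro prod.cong) auto
        then show ?thesis using True by simp
      next
        case False
        then show ?thesis using fT by (auto intro: prod_zero)
      qed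
    qed
    finally show ?thesis .
  qed
  then have "measure_pmf.expectation (random_order n) (\<lambda>\<pi>. exp (\<theta> * real (hits \<pi> S M)))
      = (\<Sum>T\<in>Pow S. ?d ^ card T * measure_pmf.prob (random_order n) {\<pi>. \<pi> ` T \<subseteq> M})"
    by (simp add: Bochner_Integration.integral_sum integrable_random_order)
  also have "\<dots> \<le> (\<Sum>T\<in>Pow S. ?d ^ card T * ?\<mu> ^ card T)"
    using prob_image_subset_le[OF M] S l by (intro sum_mono mult_left_mono) auto
  also have "\<dots> = (\<Sum>T\<in>Pow S. (\<Prod>x\<in>T. ?d * ?\<mu>) * (\<Prod>x\<in>S-T. 1))"
    by (simp add: power_mult_distrib power_divide)
  also have "\<dots> = (\<Prod>x\<in>S. ?d * ?\<mu> + 1)"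
    by (rule prod_add[OF fS, symmetric])
  finally show ?thesis by (simp add: add.commute)
qed

lemma prob_exp_markov:
  assumes "measure_pmf.expectation (random_order n) (\<lambda>\<pi>. exp (f \<pi>)) \<le> B"
  shows "measure_pmf.prob (random_order n) {\<pi>. b \<le> f \<pi>} \<le> exp (- b) * B"
proof -
  have "exp b * measure_pmf.prob (random_order n) {\<pi>. b \<le> f \<pi>}
      = measure_pmf.expectation (random_order n) (\<lambda>\<pi>. exp b * indicator {\<pi>. b \<le> f \<pi>} \<pi>)"
    by simp
  also have "\<dots> \<le> measure_pmf.expectation (random_order n) (\<lambda>\<pi>. exp (f \<pi>))"
    by (intro integral_mono integrable_random_order) (auto split: split_indicator)
  finally have "exp b * measure_pmf.prob (random_order n) {\<pi>. b \<le> f \<pi>} \<le> B"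
    using assms by simp
  then show ?thesis
    by (simp add: exp_minus field_simps)
qed

lemma prob_hits_upper:
  assumes M: "M \<subseteq> {1..n}" and S: "S \<subseteq> {1..n}" and l: "0 \<le> \<theta>"
  shows "measure_pmf.prob (random_order n) {\<pi>. a \<le> real (hits \<pi> S M)}
    \<le> exp (- \<theta> * a + real (card S) * (real (card M) / real n) * (exp \<theta> - 1))"
proof (cases "\<theta> = 0")
  case False
  let ?z = "(exp \<theta> - 1) * (real (card M) / real n)"
  have "(1 + ?z) ^ card S \<le> exp ?z ^ card S"
    using l by (intro power_mono add_nonneg_nonneg) (auto simp: exp_ge_add_one_self)
  also have "\<dots> = exp (real (card S) * (real (card M) / real n) * (exp \<theta> - 1))"
    by (simp add: exp_of_nat_mult[symmetric] mult_ac)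
  finally have B: "measure_pmf.expectation (random_order n) (\<lambda>\<pi>. exp (\<theta> * real (hits \<pi> S M)))
    \<le> exp (real (card S) * (real (card M) / real n) * (exp \<theta> - 1))"
    using mgf_hits[OF M S l] by linarith
  have "{\<pi>. a \<le> real (hits \<pi> S M)} = {\<pi>. \<theta> * a \<le> \<theta> * real (hits \<pi> S M)}"
    using False l by auto
  then show ?thesis using prob_exp_markov[OF B, of "\<theta> * a"] by (simp add: exp_add[symmetric])
qed (simp add: measure_pmf.prob_le_1)

text \<open>\<open>mgf_hits\<close> needs a nonnegative exponent, so the lower tail for M is
  obtained as the upper tail for its complement, whose hits sum with those of M to
  \<open>card S\<close>.\<close>

lemma prob_hits_lower:
  assumes M: "M \<subseteq> {1..n}" and S: "S \<subseteq> {1..n}" and l: "0 \<le> \<theta>"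
  shows "measure_pmf.prob (random_order n) {\<pi>. real (hits \<pi> S M) \<le> a}
    \<le> exp (\<theta> * a - real (card S) * (real (card M) / real n) * (1 - exp (- \<theta>)))"
proof (cases "\<theta> = 0 \<or> n = 0")
  case False
  let ?\<mu> = "real (card M) / real n" and ?c = "real (card S)"
  have fS: "finite S" using S finite_subset by blast
  have cM: "card M \<le> n" using M card_mono[of "{1..n}" M] by simp
  have "card ({1..n} - M) = n - card M" using M by (simp add: card_Diff_subset finite_subset)
  then have co: "real (card ({1..n} - M)) / real n = 1 - ?\<mu>"
    using cM False by (simp add: of_nat_diff field_simps)
  have "1 + (exp \<theta> - 1) * (1 - ?\<mu>) = exp \<theta> * (1 - (1 - exp (- \<theta>)) * ?\<mu>)"
    by (simp add: algebra_simps exp_minus)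
  also have "\<dots> \<le> exp \<theta> * exp (- ((1 - exp (- \<theta>)) * ?\<mu>))"
    using exp_ge_add_one_self[of "- ((1 - exp (- \<theta>)) * ?\<mu>)"] by (intro mult_left_mono) auto
  finally have "(1 + (exp \<theta> - 1) * (1 - ?\<mu>)) ^ card S \<le> (exp \<theta> * exp (- ((1 - exp (- \<theta>)) * ?\<mu>))) ^ card S"
    using l cM False by (intro power_mono add_nonneg_nonneg mult_nonneg_nonneg) (auto simp: field_simps)
  also have "\<dots> = exp (\<theta> * ?c - ?c * ?\<mu> * (1 - exp (- \<theta>)))"
    by (simp add: exp_of_nat_mult[symmetric] exp_add[symmetric] algebra_simps)
  finally have B: "measure_pmf.expectation (random_order n) (\<lambda>\<pi>. exp (\<theta> * real (hits \<pi> S ({1..n} - M))))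
    \<le> exp (\<theta> * ?c - ?c * ?\<mu> * (1 - exp (- \<theta>)))"
    using mgf_hits[of "{1..n} - M" n S, OF _ S l] co by fastforce
  have "measure_pmf.prob (random_order n) {\<pi>. real (hits \<pi> S M) \<le> a}
    \<le> measure_pmf.prob (random_order n) {\<pi>. \<theta> * (?c - a) \<le> \<theta> * real (hits \<pi> S ({1..n} - M))}"
  proof (rule measure_pmf.finite_measure_mono_AE)
    show "AE \<pi> in measure_pmf (random_order n). \<pi> \<in> {\<pi>. real (hits \<pi> S M) \<le> a} \<longrightarrow>
      \<pi> \<in> {\<pi>. \<theta> * (?c - a) \<le> \<theta> * real (hits \<pi> S ({1..n} - M))}"
    proof (rule AE_pmfI)
      fix \<pi> assume "\<pi> \<in> set_pmf (random_order n)"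
      then have p: "\<pi> permutes {1..n}" by (simp add: set_random_order)
      have "hits \<pi> S M + hits \<pi> S ({1..n} - M) = card ({x \<in> S. \<pi> x \<in> M} \<union> {x \<in> S. \<pi> x \<in> {1..n} - M})"
        unfolding hits_def using fS by (intro card_Un_disjoint[symmetric]) auto
      also have "{x \<in> S. \<pi> x \<in> M} \<union> {x \<in> S. \<pi> x \<in> {1..n} - M} = S"
        using S permutes_in_image[OF p] by blast
      finally have "real (hits \<pi> S ({1..n} - M)) = ?c - real (hits \<pi> S M)" by linarith
      then show "\<pi> \<in> {\<pi>. real (hits \<pi> S M) \<le> a} \<longrightarrow>
        \<pi> \<in> {\<pi>. \<theta> * (?c - a) \<le> \<theta> * real (hits \<pi> S ({1..n} - M))}"
        using l by (auto intro: mult_left_mono)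
    qed
  qed simp
  also have "\<dots> \<le> exp (- (\<theta> * (?c - a))) * exp (\<theta> * ?c - ?c * ?\<mu> * (1 - exp (- \<theta>)))"
    by (rule prob_exp_markov[OF B])
  also have "\<dots> = exp (\<theta> * a - ?c * ?\<mu> * (1 - exp (- \<theta>)))"
    by (simp add: exp_add[symmetric] algebra_simps)
  finally show ?thesis .
next
  case True
  then have "\<theta> = 0 \<or> S = {}" using S by auto
  then show ?thesis
  proof
    assume "S = {}"
    then have "{\<pi>. real (hits \<pi> S M) \<le> a} = (if 0 \<le> a then UNIV else {})"
      by (auto simp: hits_def)
    then show ?thesis using \<open>S = {}\<close> l by (auto simp: measure_pmf.prob_le_1)
  qed (simp add: measure_pmf.prob_le_1)
qed

text \<open>\<open>V\<close> is any upper bound on the mean, not the mean itself, so that a single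
  value serves all intervals of ranks inside a window.\<close>

lemma prob_hits_deviation:
  assumes M: "M \<subseteq> {1..n}" and S: "S \<subseteq> {1..n}"
    and V: "real (card S) * (real (card M) / real n) \<le> V" and a: "0 \<le> a" "a \<le> 2 * V" "0 < V"
  shows "measure_pmf.prob (random_order n)
      {\<pi>. a \<le> \<bar>real (hits \<pi> S M) - real (card S) * (real (card M) / real n)\<bar>}
    \<le> 2 * exp (- (a\<^sup>2 / (4 * V)))"
proof -
  define m where "m = real (card S) * (real (card M) / real n)"
  \<comment> \<open>The minimiser of \<open>V * \<theta>\<^sup>2 - \<theta> * a\<close>; the
    hypothesis \<open>a \<le> 2 * V\<close> keeps it at most 1, where the quadratic bound on
    \<open>exp \<theta> - 1\<close> is valid.\<close>
  define \<theta> where "\<theta> = a / (2 * V)"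
  have l: "0 \<le> \<theta>" "\<theta> \<le> 1" using a by (simp_all add: \<theta>_def)
  have m0: "0 \<le> m" by (simp add: m_def)
  have sq: "V * \<theta>\<^sup>2 - \<theta> * a = - (a\<^sup>2 / (4 * V))"
    using a by (simp add: \<theta>_def power2_eq_square field_simps)
  have e1: "exp \<theta> - 1 \<le> \<theta> + \<theta>\<^sup>2" using exp_bound[OF l] by simp
  have e2: "\<theta> - \<theta>\<^sup>2 \<le> 1 - exp (- \<theta>)"
  proof -
    have "exp (- \<theta>) \<le> 1 / (1 + \<theta>)"
      using exp_ge_add_one_self[of \<theta>] l by (simp add: exp_minus field_simps)
    also have "\<dots> \<le> 1 - \<theta> + \<theta>\<^sup>2"
      using l by (simp add: field_simps power2_eq_square)
    finally show ?thesis by simp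
  qed
  have "measure_pmf.prob (random_order n) {\<pi>. m + a \<le> real (hits \<pi> S M)}
      \<le> exp (- \<theta> * (m + a) + m * (exp \<theta> - 1))"
    unfolding m_def by (rule prob_hits_upper[OF M S l(1)])
  also have "\<dots> \<le> exp (V * \<theta>\<^sup>2 - \<theta> * a)"
  proof -
    have "m * (exp \<theta> - 1) \<le> m * (\<theta> + \<theta>\<^sup>2)" using e1 m0 by (rule mult_left_mono)
    moreover have "m * \<theta>\<^sup>2 \<le> V * \<theta>\<^sup>2" using V unfolding m_def[symmetric] by (intro mult_right_mono) auto
    ultimately show ?thesis by (simp add: algebra_simps)
  qed
  finally have up: "measure_pmf.prob (random_order n) {\<pi>. m + a \<le> real (hits \<pi> S M)}
      \<le> exp (- (a\<^sup>2 / (4 * V)))" unfolding sq .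
  have "measure_pmf.prob (random_order n) {\<pi>. real (hits \<pi> S M) \<le> m - a}
      \<le> exp (\<theta> * (m - a) - m * (1 - exp (- \<theta>)))"
    unfolding m_def by (rule prob_hits_lower[OF M S l(1)])
  also have "\<dots> \<le> exp (V * \<theta>\<^sup>2 - \<theta> * a)"
  proof -
    have "m * (\<theta> - \<theta>\<^sup>2) \<le> m * (1 - exp (- \<theta>))" using e2 m0 by (rule mult_left_mono)
    moreover have "m * \<theta>\<^sup>2 \<le> V * \<theta>\<^sup>2" using V unfolding m_def[symmetric] by (intro mult_right_mono) auto
    ultimately show ?thesis by (simp add: algebra_simps)
  qed
  finally have lo: "measure_pmf.prob (random_order n) {\<pi>. real (hits \<pi> S M) \<le> m - a}
      \<le> exp (- (a\<^sup>2 / (4 * V)))" unfolding sq .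
  have "measure_pmf.prob (random_order n) {\<pi>. a \<le> \<bar>real (hits \<pi> S M) - m\<bar>}
    \<le> measure_pmf.prob (random_order n)
        ({\<pi>. m + a \<le> real (hits \<pi> S M)} \<union> {\<pi>. real (hits \<pi> S M) \<le> m - a})"
    by (intro measure_pmf.finite_measure_mono) auto
  also have "\<dots> \<le> measure_pmf.prob (random_order n) {\<pi>. m + a \<le> real (hits \<pi> S M)}
      + measure_pmf.prob (random_order n) {\<pi>. real (hits \<pi> S M) \<le> m - a}"
    by (intro measure_Un_le) auto
  finally show ?thesis using up lo unfolding m_def by linarith
qed

section \<open>The algorithm and its deterministic analysis\<close>

text \<open>The argument \<open>c\<close> is the comparison relation known to the algorithm.
  Everything the algorithm computes is parametrised by it instead of by the hidden order, so it can
  depend on answers only.\<close>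

definition rank_below :: "(nat \<Rightarrow> nat \<Rightarrow> bool) \<Rightarrow> nat \<Rightarrow> nat \<Rightarrow> nat" where
  "rank_below c q y = card {x \<in> {1..q}. c x y}"

text \<open>
  The chain starts at the virtual position \<open>0\<close>: it is never queried, and a permutation of
  \<open>{1..n}\<close> fixes it, so it acts as an element of rank \<open>0\<close> below all others.
\<close>

primrec pivot_chain :: "(nat \<Rightarrow> nat \<Rightarrow> bool) \<Rightarrow> nat \<Rightarrow> (nat \<Rightarrow> nat) \<Rightarrow> (nat \<Rightarrow> nat) \<Rightarrow> nat \<Rightarrow> nat \<times> real" where
  "pivot_chain c n p q 0 = (0, 0)"
| "pivot_chain c n p q (Suc k) =
    (let (x, e) = pivot_chain c n p q k;
         est = (\<lambda>y. e + real n / real (q (Suc k)) *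
           (real (rank_below c (q (Suc k)) y) - real (rank_below c (q (Suc k)) x)));
         y = arg_min_on (\<lambda>y. \<bar>est y - real (n div 2)\<bar>) {1..p (Suc k)}
     in (y, est y))"

text \<open>The fine candidates \<open>{1..m}\<close> are their own sample, so their order is known
  exactly and those around \<open>x\<close> can be picked by position. Keeping \<open>x\<close>
  itself makes the set nonempty and preserves the accuracy of the chain when the fine candidates are
  of no help.\<close>

definition final_pivots :: "(nat \<Rightarrow> nat \<Rightarrow> bool) \<Rightarrow> nat \<Rightarrow> (nat \<Rightarrow> nat) \<Rightarrow> (nat \<Rightarrow> nat) \<Rightarrow> nat \<Rightarrow> nat \<Rightarrow> nat \<Rightarrow> nat set" where
  "final_pivots c n p q L m w =
    (let x = fst (pivot_chain c n p q L)
     in insert x {y \<in> {1..m}. \<bar>int (rank_below c m y) - int (rank_below c m x)\<bar> < int w})"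

text \<open>The last pivot is only known after this round and need not lie in \<open>{1..m}\<close>;
  the range up to \<open>max (p L) m\<close> locates every possible one among the fine
  candidates.\<close>

definition first_batch :: "(nat \<Rightarrow> nat) \<Rightarrow> (nat \<Rightarrow> nat) \<Rightarrow> nat \<Rightarrow> nat \<Rightarrow> (nat \<times> nat) list" where
  "first_batch p q L m =
    concat (map (\<lambda>k. List.product [1..<Suc (q k)] [1..<Suc (p k)]) [1..<Suc L]) @
    List.product [1..<Suc m] [1..<Suc (max (p L) m)]"

definition second_batch :: "nat \<Rightarrow> nat set \<Rightarrow> (nat \<times> nat) list" where
  "second_batch n V = List.product [1..<Suc n] (sorted_list_of_set V)"

text \<open>Pairs that were not queried count as \<open>False\<close>. For comparisons against the
  virtual position \<open>0\<close> this default is the correct answer.\<close>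

definition known_less :: "(nat \<times> nat) list \<Rightarrow> bool list \<Rightarrow> nat \<Rightarrow> nat \<Rightarrow> bool" where
  "known_less qs ans x y \<longleftrightarrow> map_of (zip qs ans) (x, y) = Some True"

text \<open>Against all \<open>n\<close> elements \<open>rank_below\<close> counts the strictly
  smaller ones, so its successor is the exact rank.\<close>

definition best_pivot :: "(nat \<Rightarrow> nat \<Rightarrow> bool) \<Rightarrow> nat \<Rightarrow> nat set \<Rightarrow> nat" where
  "best_pivot c n V = arg_min_on (\<lambda>v. \<bar>real (Suc (rank_below c n v)) - real (n div 2)\<bar>) V"

definition split_at :: "(nat \<Rightarrow> nat \<Rightarrow> bool) \<Rightarrow> nat \<Rightarrow> nat \<Rightarrow> comparison_tree" where
  "split_at c n v = Output {x \<in> {1..n}. \<not> c x v} {x \<in> {1..n}. c x v}"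

definition two_round_tree :: "nat \<Rightarrow> (nat \<Rightarrow> nat) \<Rightarrow> (nat \<Rightarrow> nat) \<Rightarrow> nat \<Rightarrow> nat \<Rightarrow> nat \<Rightarrow> comparison_tree" where
  "two_round_tree n p q L m w =
    Round (first_batch p q L m) (\<lambda>ans.
      let V = final_pivots (known_less (first_batch p q L m) ans) n p q L m w
      in Round (second_batch n V) (\<lambda>ans'.
           let c = known_less (second_batch n V) ans' in split_at c n (best_pivot c n V)))"

lemma known_less_answers:
  "known_less qs (answers \<pi> qs) x y \<longleftrightarrow> (x, y) \<in> set qs \<and> \<pi> x < \<pi> y"
  by (simp add: known_less_def answers_def map_of_zip_map)

lemma set_first_batch:
  "(x, y) \<in> set (first_batch p q L m) \<longleftrightarrow>
    (\<exists>k\<in>{1..L}. x \<in> {1..q k} \<and> y \<in> {1..p k}) \<or> (x \<in> {1..m} \<and> y \<in> {1..max (p L) m})"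
  by (auto simp: first_batch_def less_Suc_eq_le simp del: upt_Suc)

lemma length_first_batch:
  "length (first_batch p q L m) = (\<Sum>k=1..L. q k * p k) + m * max (p L) m"
proof -
  have "sum_list (map (\<lambda>k. q k * p k) [1..<Suc L]) = (\<Sum>k=1..L. q k * p k)"
    by (simp add: sum_list_distinct_conv_sum_set atLeastLessThanSuc_atLeastAtMost del: upt_Suc)
  then show ?thesis
    by (simp add: first_batch_def length_concat comp_def del: upt_Suc)
qed

lemma arg_min_on_mem:
  assumes "finite S" "S \<noteq> {}"
  shows "arg_min_on (f :: _ \<Rightarrow> real) S \<in> S"
  using arg_min_if_finite(1)[OF assms] .

section \<open>Validity and round count of the scheme\<close>

locale two_round_scheme =
  fixes n L m w :: nat and p q :: "nat \<Rightarrow> nat"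
  assumes L_pos: "1 \<le> L"
    and p_bounds: "\<And>k. k \<in> {1..L} \<Longrightarrow> 1 \<le> p k \<and> p k \<le> n"
    and q_bounds: "\<And>k. k \<in> {1..L} \<Longrightarrow> 1 \<le> q k \<and> q k \<le> n"
    and p_mono: "\<And>j k. 1 \<le> j \<Longrightarrow> j \<le> k \<Longrightarrow> k \<le> L \<Longrightarrow> p j \<le> p k"
    and m_le: "m \<le> n"
begin

lemma pivot_chain_mem:
  assumes "k \<in> {1..L}"
  shows "fst (pivot_chain c n p q k) \<in> {1..p k}"
proof -
  obtain j where j: "k = Suc j" using assms by (cases k) auto
  have "{1..p k} \<noteq> {}" using p_bounds[OF assms] by simp
  then show ?thesis
    unfolding j by (auto simp: Let_def split: prod.splits intro!: arg_min_on_mem simp del: atLeastAtMost_iff)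
qed

lemma final_pivots_props:
  "final_pivots c n p q L m w \<subseteq> {1..n}" "finite (final_pivots c n p q L m w)"
  "final_pivots c n p q L m w \<noteq> {}"
  using pivot_chain_mem[of L c] p_bounds[of L] L_pos m_le
  by (auto simp: final_pivots_def Let_def)

lemma partition_tree_two_round: "partition_tree n (two_round_tree n p q L m w)"
proof -
  have "set (first_batch p q L m) \<subseteq> {1..n} \<times> {1..n}"
  proof (rule subrelI)
    fix x y assume "(x, y) \<in> set (first_batch p q L m)"
    then consider k where "k \<in> {1..L}" "x \<in> {1..q k}" "y \<in> {1..p k}"
      | "x \<in> {1..m}" "y \<in> {1..max (p L) m}"
      unfolding set_first_batch by blast
    then show "(x, y) \<in> {1..n} \<times> {1..n}"
    proof cases
      case (1 k)
      then show ?thesis using p_bounds[of k] q_bounds[of k] by auto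
    next
      case 2
      then show ?thesis using p_bounds[of L] L_pos m_le by auto
    qed
  qed
  moreover have "set (second_batch n (final_pivots c n p q L m w)) \<subseteq> {1..n} \<times> {1..n}" for c
    using final_pivots_props[of c] by (auto simp: second_batch_def)
  ultimately show ?thesis
    by (auto simp: two_round_tree_def Let_def split_at_def)
qed

lemma rounds_two_round: "rounds \<pi> (two_round_tree n p q L m w) = 2"
  by (simp add: two_round_tree_def Let_def split_at_def)

end

section \<open>The scheme on one fixed input order: cost, output and accuracy\<close>

locale two_round_run = two_round_scheme +
  fixes \<pi> :: "nat \<Rightarrow> nat"
  assumes perm: "\<pi> permutes {1..n}"
begin

definition c1 :: "nat \<Rightarrow> nat \<Rightarrow> bool" where
  "c1 = known_less (first_batch p q L m) (answers \<pi> (first_batch p q L m))"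

abbreviation pivot :: "nat \<Rightarrow> nat" where "pivot k \<equiv> fst (pivot_chain c1 n p q k)"
abbreviation est_rank :: "nat \<Rightarrow> real" where "est_rank k \<equiv> snd (pivot_chain c1 n p q k)"
abbreviation V :: "nat set" where "V \<equiv> final_pivots c1 n p q L m w"

lemma pi_zero: "\<pi> 0 = 0" using perm by (simp add: permutes_not_in)

lemma pi_inj: "\<pi> x = \<pi> y \<longleftrightarrow> x = y" using permutes_inj[OF perm] by (auto simp: inj_def)

lemma pi_mem: "\<pi> x \<in> {1..n} \<longleftrightarrow> x \<in> {1..n}" by (rule permutes_in_image[OF perm])

lemma pi_le: "x \<le> n \<Longrightarrow> \<pi> x \<le> n"
  using pi_mem[of x] pi_zero by (cases "x = 0") auto

lemma rank_below_c1:
  assumes k: "k \<in> {1..L}" and y: "y \<le> p k"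
  shows "rank_below c1 (q k) y = hits \<pi> {1..q k} {..<\<pi> y}"
proof (cases "y = 0")
  \<comment> \<open>The virtual start of the chain: the default of \<open>known_less\<close> gives
    0, and so does \<open>\<pi> 0 = 0\<close>.\<close>
  case True
  then show ?thesis
    by (simp add: rank_below_def hits_def c1_def known_less_answers pi_zero)
next
  case False
  then have "(x, y) \<in> set (first_batch p q L m)" if "x \<in> {1..q k}" for x
    using that k y unfolding set_first_batch by (intro disjI1 bexI[OF _ k]) auto
  then show ?thesis
    unfolding rank_below_def hits_def c1_def known_less_answers by (intro arg_cong[where f = card]) auto
qed

lemma rank_below_c1_final:
  assumes "y \<in> {1..max (p L) m}"
  shows "rank_below c1 m y = hits \<pi> {1..m} {..<\<pi> y}"
  using assms unfolding rank_below_def hits_def c1_def known_less_answers set_first_batch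
  by (intro arg_cong[where f = card]) auto

text \<open>Distinct elements of \<open>{1..m}\<close> have distinct ranks within
  \<open>{1..m}\<close>, and only those in an open interval of length \<open>2 * w\<close> are
  selected. The bound holds for every order, as the worst-case query count demands.\<close>

lemma card_V_le: "card V \<le> 2 * w + 1"
proof -
  let ?x = "pivot L" and ?N = "\<lambda>y. hits \<pi> {1..m} {..<\<pi> y}"
  let ?S = "{y \<in> {1..m}. \<bar>int (rank_below c1 m y) - int (rank_below c1 m ?x)\<bar> < int w}"
  have inj: "inj_on ?N {1..m}"
  proof (rule linorder_inj_onI)
    have less: "?N y < ?N z" if "\<pi> y < \<pi> z" "y \<in> {1..m}" for y z
      unfolding hits_def using that by (intro psubset_card_mono) auto
    fix y z assume "y < z" "y \<in> {1..m}" "z \<in> {1..m}"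
    then show "?N y \<noteq> ?N z" using less[of y z] less[of z y] pi_inj[of y z]
      by (cases "\<pi> y" "\<pi> z" rule: linorder_cases) auto
  qed auto
  have "inj_on (\<lambda>y. int (rank_below c1 m y)) ?S"
  proof (rule inj_onI)
    fix y z assume "y \<in> ?S" "z \<in> ?S" "int (rank_below c1 m y) = int (rank_below c1 m z)"
    then show "y = z" using inj_onD[OF inj, of y z] by (auto simp: rank_below_c1_final)
  qed
  then have "card ?S = card ((\<lambda>y. int (rank_below c1 m y)) ` ?S)" by (simp add: card_image)
  also have "\<dots> \<le> card {int (rank_below c1 m ?x) - int w <..< int (rank_below c1 m ?x) + int w}"
    by (intro card_mono) auto
  also have "\<dots> \<le> 2 * w" by simp
  finally have "card ?S \<le> 2 * w" .
  moreover have "card V \<le> Suc (card ?S)"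
    unfolding final_pivots_def Let_def by (rule card_insert_le_m1) auto
  ultimately show ?thesis by linarith
qed

lemma queries_two_round:
  "queries \<pi> (two_round_tree n p q L m w) \<le> (\<Sum>k=1..L. q k * p k) + m * max (p L) m + n * (2 * w + 1)"
proof -
  have "queries \<pi> (two_round_tree n p q L m w) = length (first_batch p q L m) + n * card V"
    by (simp add: two_round_tree_def Let_def split_at_def c1_def second_batch_def del: upt_Suc)
  then show ?thesis using mult_le_mono2[OF card_V_le, of n] by (simp only: length_first_batch)
qed

text \<open>The second round compares each member of \<open>V\<close> with all elements, so exact
  ranks are available and the output is a split at the best of them. In terms of ranks it is
  determined by \<open>\<pi> v\<close> alone, with the pivot itself accepted.\<close>

lemma run_two_round:
  obtains v where "v \<in> V" "\<And>y. y \<in> V \<Longrightarrow> \<bar>real (\<pi> v) - real (n div 2)\<bar> \<le> \<bar>real (\<pi> y) - real (n div 2)\<bar>"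
    "map_prod (image \<pi>) (image \<pi>) (run \<pi> (two_round_tree n p q L m w)) = ({\<pi> v..n}, {1..<\<pi> v})"
proof -
  define c2 where "c2 = known_less (second_batch n V) (answers \<pi> (second_batch n V))"
  define v where "v = best_pivot c2 n V"
  note V = final_pivots_props[of c1]
  have c2: "c2 x y \<longleftrightarrow> \<pi> x < \<pi> y" if "x \<in> {1..n}" "y \<in> V" for x y
    using that V(2) unfolding c2_def known_less_answers second_batch_def by (auto simp del: upt_Suc)
  have low: "\<pi> ` {x \<in> {1..n}. \<pi> x < \<pi> y} = {1..<\<pi> y}" if "y \<in> {1..n}" for y
  proof
    show "{1..<\<pi> y} \<subseteq> \<pi> ` {x \<in> {1..n}. \<pi> x < \<pi> y}"
    proof
      fix i assume i: "i \<in> {1..<\<pi> y}"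
      then have "i \<in> {1..n}" using pi_mem[of y] that by auto
      then have "i \<in> \<pi> ` {1..n}" by (simp only: permutes_image[OF perm])
      then obtain x where "x \<in> {1..n}" "\<pi> x = i" by (elim imageE) simp
      then show "i \<in> \<pi> ` {x \<in> {1..n}. \<pi> x < \<pi> y}" using i by auto
    qed
    show "\<pi> ` {x \<in> {1..n}. \<pi> x < \<pi> y} \<subseteq> {1..<\<pi> y}"
    proof (rule image_subsetI)
      fix x assume x: "x \<in> {x \<in> {1..n}. \<pi> x < \<pi> y}"
      then have "\<pi> x \<in> {1..n}" unfolding pi_mem by simp
      then show "\<pi> x \<in> {1..<\<pi> y}" using x by simp
    qed
  qed
  have rank: "Suc (rank_below c2 n y) = \<pi> y" if y: "y \<in> V" for y
  proof -
    have yn: "y \<in> {1..n}" using y V(1) by blast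
    have "rank_below c2 n y = card {x \<in> {1..n}. \<pi> x < \<pi> y}"
      unfolding rank_below_def using c2 y by (intro arg_cong[where f = card]) auto
    also have "\<dots> = card (\<pi> ` {x \<in> {1..n}. \<pi> x < \<pi> y})"
      by (rule card_image[symmetric]) (auto simp: inj_on_def pi_inj)
    also have "\<dots> = \<pi> y - 1" using low[OF yn] by simp
    finally show ?thesis using pi_mem[of y] yn by simp
  qed
  show thesis
  proof
    show vV: "v \<in> V" unfolding v_def best_pivot_def by (rule arg_min_on_mem[OF V(2,3)])
    show "\<bar>real (\<pi> v) - real (n div 2)\<bar> \<le> \<bar>real (\<pi> y) - real (n div 2)\<bar>" if "y \<in> V" for y
      using arg_min_least[OF V(2,3) that, of "\<lambda>v. \<bar>real (Suc (rank_below c2 n v)) - real (n div 2)\<bar>"]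
      unfolding best_pivot_def[symmetric] v_def[symmetric] rank[OF vV] rank[OF that] .
    have "run \<pi> (two_round_tree n p q L m w) = ({x \<in> {1..n}. \<not> c2 x v}, {x \<in> {1..n}. c2 x v})"
      by (simp add: two_round_tree_def Let_def split_at_def c1_def[symmetric] c2_def[symmetric] v_def[symmetric])
    also have "\<dots> = ({1..n} - {x \<in> {1..n}. \<pi> x < \<pi> v}, {x \<in> {1..n}. \<pi> x < \<pi> v})"
      using c2[OF _ vV] by auto
    finally have run: "run \<pi> (two_round_tree n p q L m w)
      = ({1..n} - {x \<in> {1..n}. \<pi> x < \<pi> v}, {x \<in> {1..n}. \<pi> x < \<pi> v})" .
    have vn: "v \<in> {1..n}" using vV V(1) by blast
    have "\<pi> ` ({1..n} - {x \<in> {1..n}. \<pi> x < \<pi> v}) = {1..n} - {1..<\<pi> v}"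
      by (subst image_set_diff[OF permutes_inj[OF perm]]) (simp only: low[OF vn] permutes_image[OF perm])
    also have "\<dots> = {\<pi> v..n}" using pi_mem[of v] vn by auto
    finally show "map_prod (image \<pi>) (image \<pi>) (run \<pi> (two_round_tree n p q L m w)) = ({\<pi> v..n}, {1..<\<pi> v})"
      unfolding run map_prod_simp low[OF vn] by simp
  qed
qed

text \<open>Each level adds at most \<open>2 * E\<close> to the error of the estimate:
  \<open>E\<close> for the new pivot and \<open>E\<close> for the old one. A candidate within
  \<open>g k\<close> of the median has an estimate within \<open>g k + 2 * k * E\<close>, hence so
  does the minimiser, whose true rank is then within \<open>g k + 4 * k * E\<close>. The delicate
  point is that \<open>fluct\<close> says nothing about candidates outside the previous
  window.\<close>

lemma pivot_chain_accuracy: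
  fixes E :: real and g W :: "nat \<Rightarrow> real"
  assumes E: "0 \<le> E"
    and W0: "real n \<le> W 0"
    and fluct: "\<And>k v. k \<in> {1..L} \<Longrightarrow> v \<le> n \<Longrightarrow> \<bar>real v - real (n div 2)\<bar> \<le> W (k - 1) \<Longrightarrow>
      \<bar>real n / real (q k) * (real (hits \<pi> {1..q k} {..<v}) - real (hits \<pi> {1..q k} {..<n div 2}))
        - (real v - real (n div 2))\<bar> \<le> E"
    and near: "\<And>k. k \<in> {1..L} \<Longrightarrow> \<exists>y\<in>{1..p k}. \<bar>real (\<pi> y) - real (n div 2)\<bar> \<le> g k"
    and width: "\<And>k. k \<in> {1..L} \<Longrightarrow> g k + 4 * real L * E + 1 < W (k - 1)"
      "\<And>k. k \<in> {1..L} \<Longrightarrow> g k + 4 * real L * E \<le> W k"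
  shows "k \<le> L \<Longrightarrow> (k = 0 \<longrightarrow> pivot k = 0) \<and> \<bar>est_rank k - real (\<pi> (pivot k))\<bar> \<le> 2 * real k * E
    \<and> \<bar>real (\<pi> (pivot k)) - real (n div 2)\<bar> \<le> W k"
proof (induction k)
  case 0
  then show ?case using W0 by (simp add: pi_zero)
next
  case (Suc j)
  let ?h = "n div 2" and ?k = "Suc j" and ?Q = "{1..q (Suc j)}"
  let ?G = "\<lambda>v. real (hits \<pi> ?Q {..<v})"
  define r where "r = real n / real (q ?k)"
  define x where "x = pivot j"
  define e where "e = est_rank j"
  have k: "?k \<in> {1..L}" using Suc by auto
  have r: "0 \<le> r" by (simp add: r_def)
  have IH: "\<bar>e - real (\<pi> x)\<bar> \<le> 2 * real j * E" "\<bar>real (\<pi> x) - real ?h\<bar> \<le> W j"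
    using Suc unfolding x_def e_def by auto
  \<comment> \<open>Monotone \<open>p\<close> keeps the old pivot among the candidates of the new
    level, so it too was compared with the new sample.\<close>
  have xp: "x \<le> p ?k"
  proof (cases "j = 0")
    case False
    then have "j \<in> {1..L}" using Suc by auto
    then have "x \<le> p j" using pivot_chain_mem[of j c1] by (auto simp: x_def)
    also have "\<dots> \<le> p ?k" using False Suc by (intro p_mono) auto
    finally show ?thesis .
  qed (simp add: x_def)
  have le_n: "y \<le> n" if "y \<le> p ?k" for y using that p_bounds[OF k] by simp
  define est where "est y = e + r * (?G (\<pi> y) - ?G (\<pi> x))" for y
  define y where "y = arg_min_on (\<lambda>y. \<bar>est y - real ?h\<bar>) {1..p ?k}"
  have est0: "e + real n / real (q ?k) * (real (rank_below c1 (q ?k) y) - real (rank_below c1 (q ?k) x)) = est y"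
    if "y \<in> {1..p ?k}" for y
    using that by (simp add: est_def r_def rank_below_c1[OF k xp] rank_below_c1[OF k, of y])
  \<comment> \<open>\<open>arg_min_on\<close> is a choice operator, and the two functions agree only
    on the candidates. Equality follows because the minimality predicates coincide.\<close>
  have y0: "y = arg_min_on (\<lambda>y. \<bar>e + real n / real (q ?k) * (real (rank_below c1 (q ?k) y) - real (rank_below c1 (q ?k) x)) - real ?h\<bar>) {1..p ?k}"
    unfolding y_def arg_min_on_def arg_min_def is_arg_min_def
    by (rule arg_cong[where f = Eps]) (use est0 in \<open>auto simp: fun_eq_iff\<close>)
  have ne: "{1..p ?k} \<noteq> {}" using p_bounds[OF k] by simp
  have yp: "y \<in> {1..p ?k}" unfolding y_def by (rule arg_min_on_mem[OF _ ne]) simp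
  have "pivot_chain c1 n p q j = (x, e)" by (simp add: x_def e_def)
  then have "pivot_chain c1 n p q ?k = (y, est y)"
    by (simp only: pivot_chain.simps Let_def prod.case y0[symmetric] est0[OF yp])
  then have chain: "pivot ?k = y" "est_rank ?k = est y" by simp_all
  \<comment> \<open>The detour through the median means that fluctuations are needed only for
    intervals with one end fixed, not for all pairs of ranks.\<close>
  have F: "\<bar>r * (?G v - ?G u) - (real v - real u)\<bar> \<le> 2 * E"
    if "v \<le> n" "\<bar>real v - real ?h\<bar> \<le> W j" "u \<le> n" "\<bar>real u - real ?h\<bar> \<le> W j" for u v
  proof -
    have "\<bar>r * (?G v - ?G ?h) - (real v - real ?h)\<bar> \<le> E" "\<bar>r * (?G u - ?G ?h) - (real u - real ?h)\<bar> \<le> E"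
      using fluct[OF k, of v] fluct[OF k, of u] that by (simp_all add: r_def)
    then show ?thesis by (simp add: abs_le_iff algebra_simps)
  qed
  have est_err: "\<bar>e + r * (?G v - ?G (\<pi> x)) - real v\<bar> \<le> 2 * real ?k * E" if "v \<le> n" "\<bar>real v - real ?h\<bar> \<le> W j" for v
    using F[OF that pi_le[OF le_n[OF xp]] IH(2)] IH(1) by (simp add: abs_le_iff algebra_simps)
  have kL: "2 * real ?k * E \<le> 2 * real L * E" using k E by (intro mult_right_mono) auto
  obtain z where z: "z \<in> {1..p ?k}" "\<bar>real (\<pi> z) - real ?h\<bar> \<le> g ?k" using near[OF k] by blast
  have wd: "g ?k + 4 * real L * E + 1 < W j" "g ?k + 4 * real L * E \<le> W ?k"
    using width[OF k] by simp_all
  have LE: "0 \<le> real L * E" using E by simp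
  have "\<bar>real (\<pi> z) - real ?h\<bar> \<le> W j" using z(2) wd LE by linarith
  then have "\<bar>est z - real (\<pi> z)\<bar> \<le> 2 * real ?k * E"
    unfolding est_def using z(1) by (intro est_err pi_le le_n) auto
  moreover have "\<bar>est y - real ?h\<bar> \<le> \<bar>est z - real ?h\<bar>"
    unfolding y_def by (rule arg_min_least[OF _ ne z(1), of "\<lambda>y. \<bar>est y - real ?h\<bar>"]) simp
  ultimately have esty: "\<bar>est y - real ?h\<bar> \<le> g ?k + 2 * real ?k * E" using z(2) by linarith
  have yn: "\<pi> y \<le> n" using yp by (intro pi_le le_n) auto
  have mono: "?G u \<le> ?G v" if "u \<le> v" for u v
    unfolding hits_def using that by (intro of_nat_mono card_mono) auto
  \<comment> \<open>Estimates are monotone in the true rank. A candidate beyond the window has an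
    estimate at least as extreme as that of a rank \<open>v\<close> at the edge, where
    \<open>fluct\<close> applies, and this is too far from the median to win.\<close>
  have inW: "\<bar>real (\<pi> y) - real ?h\<bar> \<le> W j"
  proof (rule ccontr)
    assume "\<not> ?thesis"
    then consider "real (\<pi> y) > real ?h + W j" | "real (\<pi> y) < real ?h - W j" by linarith
    then show False
    proof cases
      case 1
      \<comment> \<open>Rounding the edge inwards loses less than 1, which is the \<open>+ 1\<close>
        in the first \<open>width\<close> condition.\<close>
      define v where "v = nat \<lfloor>real ?h + W j\<rfloor>"
      have W: "0 \<le> W j" using IH(2) by linarith
      then have v: "real v \<le> real ?h + W j" "real ?h + W j < real v + 1"
        unfolding v_def by linarith+
      then have vy: "v \<le> \<pi> y" using 1 by linarith
      have "\<bar>real v - real ?h\<bar> \<le> W j" using v wd LE z(2) by linarith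
      then have "\<bar>e + r * (?G v - ?G (\<pi> x)) - real v\<bar> \<le> 2 * real ?k * E"
        using vy yn by (intro est_err) auto
      moreover have "r * (?G v - ?G (\<pi> x)) \<le> r * (?G (\<pi> y) - ?G (\<pi> x))"
        using mono[OF vy] r by (intro mult_left_mono) auto
      ultimately have "est y \<ge> real v - 2 * real ?k * E" unfolding est_def by linarith
      then show False using esty v wd kL by linarith
    next
      case 2
      define v where "v = nat \<lceil>real ?h - W j\<rceil>"
      have v: "real ?h - W j \<le> real v" "real v < real ?h - W j + 1"
        using 2 unfolding v_def by linarith+
      then have vy: "\<pi> y \<le> v" using 2 by linarith
      have vh: "real v \<le> real ?h" using v wd LE z(2) by linarith
      then have "v \<le> n" by simp
      have "\<bar>real v - real ?h\<bar> \<le> W j" using v vh by linarith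
      then have "\<bar>e + r * (?G v - ?G (\<pi> x)) - real v\<bar> \<le> 2 * real ?k * E"
        using \<open>v \<le> n\<close> by (intro est_err) auto
      moreover have "r * (?G (\<pi> y) - ?G (\<pi> x)) \<le> r * (?G v - ?G (\<pi> x))"
        using mono[OF vy] r by (intro mult_left_mono) auto
      ultimately have "est y \<le> real v + 2 * real ?k * E" unfolding est_def by linarith
      then show False using esty v wd kL by linarith
    qed
  qed
  have "\<bar>est y - real (\<pi> y)\<bar> \<le> 2 * real ?k * E"
    unfolding est_def by (rule est_err[OF yn inW])
  moreover from this have "\<bar>real (\<pi> y) - real ?h\<bar> \<le> W ?k" using esty wd(2) kL by linarith
  ultimately show ?case unfolding chain by simp
qed

text \<open>Both \<open>y\<close> and the last pivot lie in the window, so every fine candidate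
  between them has its rank there too; fewer than \<open>w\<close> such candidates exist.\<close>

lemma final_pivots_near:
  fixes W g :: real
  assumes x: "\<bar>real (\<pi> (pivot L)) - real (n div 2)\<bar> \<le> W"
    and y: "y \<in> {1..m}" "\<bar>real (\<pi> y) - real (n div 2)\<bar> \<le> W"
    and few: "hits \<pi> {1..m} {i \<in> {1..n}. \<bar>real i - real (n div 2)\<bar> \<le> W} < w"
  shows "y \<in> V"
proof -
  let ?x = "pivot L" and ?N = "\<lambda>v. hits \<pi> {1..m} {..<v}" and ?h = "real (n div 2)"
  have diff: "?N v - ?N u < w \<and> ?N u \<le> ?N v"
    if "u \<le> v" "\<bar>real u - ?h\<bar> \<le> W" "\<bar>real v - ?h\<bar> \<le> W" for u v
  proof -
    have sub: "{x \<in> {1..m}. \<pi> x \<in> {..<u}} \<subseteq> {x \<in> {1..m}. \<pi> x \<in> {..<v}}" using that by auto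
    have "?N v - ?N u = card ({x \<in> {1..m}. \<pi> x \<in> {..<v}} - {x \<in> {1..m}. \<pi> x \<in> {..<u}})"
      unfolding hits_def using sub by (intro card_Diff_subset[symmetric]) auto
    also have "\<dots> \<le> hits \<pi> {1..m} {i \<in> {1..n}. \<bar>real i - ?h\<bar> \<le> W}"
      unfolding hits_def
    proof (rule card_mono)
      show "{x \<in> {1..m}. \<pi> x \<in> {..<v}} - {x \<in> {1..m}. \<pi> x \<in> {..<u}}
        \<subseteq> {x \<in> {1..m}. \<pi> x \<in> {i \<in> {1..n}. \<bar>real i - ?h\<bar> \<le> W}}"
      proof
        fix z assume z: "z \<in> {x \<in> {1..m}. \<pi> x \<in> {..<v}} - {x \<in> {1..m}. \<pi> x \<in> {..<u}}"
        then have "real u \<le> real (\<pi> z)" "real (\<pi> z) \<le> real v" by auto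
        then have "\<bar>real (\<pi> z) - ?h\<bar> \<le> W" using that by linarith
        moreover have "\<pi> z \<in> {1..n}" using z m_le unfolding pi_mem by auto
        ultimately show "z \<in> {x \<in> {1..m}. \<pi> x \<in> {i \<in> {1..n}. \<bar>real i - ?h\<bar> \<le> W}}" using z by blast
      qed
    qed simp
    also have "\<dots> < w" by (rule few)
    finally show ?thesis using card_mono[OF _ sub] by (simp add: hits_def)
  qed
  have "?x \<in> {1..max (p L) m}" "y \<in> {1..max (p L) m}"
    using pivot_chain_mem[of L c1] L_pos y by auto
  then have "\<bar>int (rank_below c1 m y) - int (rank_below c1 m ?x)\<bar> < int w"
    using diff[of "\<pi> ?x" "\<pi> y"] diff[of "\<pi> y" "\<pi> ?x"] x y(2) nat_le_linear[of "\<pi> ?x" "\<pi> y"]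
    by (auto simp: rank_below_c1_final)
  then show ?thesis using y(1) by (simp add: final_pivots_def Let_def)
qed

end

text \<open>Only ranks between \<open>u\<close> and the median are misplaced, all on one side, so
  one of the two sums vanishes. The \<open>+ 1\<close> pays both for counting the end points and for
  the half unit between \<open>n / 2\<close> and \<open>n div 2\<close>.\<close>

lemma weighted_error_threshold:
  assumes c: "0 \<le> c"
  shows "weighted_error n c ({u..n}, {1..<u}) \<le> (\<bar>real u - real (n div 2)\<bar> + 1) powr (c + 1)"
proof -
  let ?h = "n div 2" let ?D = "\<bar>real u - real ?h\<bar>"
  let ?S = "{i \<in> {1..n}. real i > real n / 2}" and ?T = "{i \<in> {1..n}. real i < real n / 2}"
  have n2: "real n / 2 - 1 / 2 \<le> real ?h" "real ?h \<le> real n / 2" by (simp_all add: field_simps)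
  have hn: "?h \<le> i" if "real i > real n / 2" for i using that n2 by linarith
  have bd: "(\<Sum>i\<in>X. f i) \<le> (?D + 1) powr (c + 1)"
    if X: "X \<subseteq> {a..b}" "real (card {a..b}) \<le> ?D + 1"
      and f: "\<And>i. i \<in> X \<Longrightarrow> f i \<le> (?D + 1) powr c" for f :: "nat \<Rightarrow> real" and X a b
  proof -
    have "(\<Sum>i\<in>X. f i) \<le> real (card X) * (?D + 1) powr c" using f by (rule sum_bounded_above)
    also have "\<dots> \<le> (?D + 1) * (?D + 1) powr c"
      using card_mono[OF _ X(1)] X(2) by (intro mult_right_mono) auto
    also have "\<dots> = (?D + 1) powr (c + 1)" by (simp add: powr_add)
    finally show ?thesis .
  qed
  show ?thesis
  proof (cases "u \<le> ?h")
    case True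
    have "(\<Sum>i\<in>?S. indicator {1..<u} i * \<bar>real i - real n / 2\<bar> powr c) = 0"
      using True hn by (intro sum.neutral) (auto split: split_indicator dest!: hn)
    moreover have "(\<Sum>i\<in>?T. indicator {u..n} i * \<bar>real i - real n / 2\<bar> powr c)
      = (\<Sum>i\<in>?T \<inter> {u..n}. \<bar>real i - real n / 2\<bar> powr c)"
      by (rule sum.mono_neutral_cong_right) (auto split: split_indicator)
    moreover have "\<dots> \<le> (?D + 1) powr (c + 1)"
    proof (rule bd)
      show "?T \<inter> {u..n} \<subseteq> {u..?h}" using n2 by auto
      show "real (card {u..?h}) \<le> ?D + 1" using True by simp
      fix i assume "i \<in> ?T \<inter> {u..n}"
      then show "\<bar>real i - real n / 2\<bar> powr c \<le> (?D + 1) powr c"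
        using True n2 c by (intro powr_mono2) auto
    qed
    ultimately show ?thesis by (simp add: weighted_error_def)
  next
    case False
    have "(\<Sum>i\<in>?T. indicator {u..n} i * \<bar>real i - real n / 2\<bar> powr c) = 0"
      using False n2 by (intro sum.neutral) (auto split: split_indicator)
    moreover have "(\<Sum>i\<in>?S. indicator {1..<u} i * \<bar>real i - real n / 2\<bar> powr c)
      = (\<Sum>i\<in>?S \<inter> {1..<u}. \<bar>real i - real n / 2\<bar> powr c)"
      by (rule sum.mono_neutral_cong_right) (auto split: split_indicator)
    moreover have "\<dots> \<le> (?D + 1) powr (c + 1)"
    proof (rule bd)
      show "?S \<inter> {1..<u} \<subseteq> {?h..u}" using hn by auto
      show "real (card {?h..u}) \<le> ?D + 1" using False by simp
      fix i assume "i \<in> ?S \<inter> {1..<u}"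
      then have "real i > real n / 2" "real i \<le> real u" by auto
      then have "\<bar>real i - real n / 2\<bar> \<le> ?D + 1" using n2 by linarith
      then show "\<bar>real i - real n / 2\<bar> powr c \<le> (?D + 1) powr c"
        using c by (intro powr_mono2) auto
    qed
    ultimately show ?thesis by (simp add: weighted_error_def)
  qed
qed

section \<open>The probability of a good run\<close>

text \<open>This and the next two events negate the hypotheses \<open>fluct\<close> and
  \<open>near\<close> of \<open>pivot_chain_accuracy\<close> and \<open>few\<close> of
  \<open>final_pivots_near\<close>. They are centred at the median, so they do not mention the
  random pivots.\<close>

definition fluctuating :: "nat \<Rightarrow> nat \<Rightarrow> real \<Rightarrow> real \<Rightarrow> (nat \<Rightarrow> nat) set" where
  "fluctuating n q W E = {\<pi>. \<exists>v\<le>n. \<bar>real v - real (n div 2)\<bar> \<le> W \<and>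
     E < \<bar>real n / real q * (real (hits \<pi> {1..q} {..<v}) - real (hits \<pi> {1..q} {..<n div 2}))
        - (real v - real (n div 2))\<bar>}"

definition avoiding :: "nat \<Rightarrow> nat \<Rightarrow> real \<Rightarrow> (nat \<Rightarrow> nat) set" where
  "avoiding n p g = {\<pi>. \<forall>y\<in>{1..p}. g < \<bar>real (\<pi> y) - real (n div 2)\<bar>}"

definition crowded :: "nat \<Rightarrow> nat \<Rightarrow> real \<Rightarrow> nat \<Rightarrow> (nat \<Rightarrow> nat) set" where
  "crowded n m W w = {\<pi>. w \<le> hits \<pi> {1..m} {i \<in> {1..n}. \<bar>real i - real (n div 2)\<bar> \<le> W}}"

lemma hits_lessThan_split:
  assumes "finite S" "u \<le> v"
  shows "hits \<pi> S {..<v} = hits \<pi> S {..<u} + hits \<pi> S {u..<v}"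
proof -
  have "hits \<pi> S {..<u} + hits \<pi> S {u..<v} = card ({x \<in> S. \<pi> x \<in> {..<u}} \<union> {x \<in> S. \<pi> x \<in> {u..<v}})"
    unfolding hits_def using assms by (intro card_Un_disjoint[symmetric]) auto
  also have "{x \<in> S. \<pi> x \<in> {..<u}} \<union> {x \<in> S. \<pi> x \<in> {u..<v}} = {x \<in> S. \<pi> x \<in> {..<v}}"
    using assms by auto
  finally show ?thesis by (simp add: hits_def)
qed

text \<open>Up to the scaling \<open>n / q\<close>, the deviation is that of the hits of the
  interval between \<open>v\<close> and the median from their mean. The two conditions say that
  \<open>V\<close> dominates this mean and that \<open>a \<le> 2 * V\<close>.\<close>

lemma prob_fluctuation_at:
  fixes E W \<tau> :: real
  assumes n: "2 \<le> n" and q: "1 \<le> q" "q \<le> n" and v: "1 \<le> v" "v \<le> n"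
    and W: "\<bar>real v - real (n div 2)\<bar> \<le> W" and E: "0 < E" "0 < \<tau>"
    and cond: "4 * real n * W * \<tau> \<le> E\<^sup>2 * real q" "2 * real n * \<tau> \<le> E * real q"
  shows "measure_pmf.prob (random_order n) {\<pi>. E <
      \<bar>real n / real q * (real (hits \<pi> {1..q} {..<v}) - real (hits \<pi> {1..q} {..<n div 2}))
        - (real v - real (n div 2))\<bar>} \<le> 2 * exp (- \<tau>)"
proof -
  let ?h = "n div 2"
  define M where "M = {min v ?h..<max v ?h}"
  define \<mu> where "\<mu> = real (card M) / real n"
  define a where "a = E * real q / real n"
  \<comment> \<open>Solved from \<open>a\<^sup>2 / (4 * V) = \<tau>\<close>.\<close>
  define V where "V = E\<^sup>2 * (real q)\<^sup>2 / (4 * (real n)\<^sup>2 * \<tau>)"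
  have h: "1 \<le> ?h" "?h \<le> n" using n by auto
  have n0: "real n > 0" and q0: "real q > 0" using n q by auto
  have M: "M \<subseteq> {1..n}" using h v by (auto simp: M_def)
  have cM: "real (card M) = \<bar>real v - real ?h\<bar>"
    by (cases "v \<le> ?h") (simp_all add: M_def min_def max_def of_nat_diff)
  have a0: "0 < a" using E n0 q0 by (simp add: a_def)
  have V0: "0 < V" using E n0 q0 by (simp add: V_def)
  have "real q * W / real n \<le> V"
  proof -
    have "(4 * real n * W * \<tau>) * real q \<le> (E\<^sup>2 * real q) * real q"
      using cond(1) q0 by (intro mult_right_mono) auto
    then show ?thesis using E n0 unfolding V_def
      by (simp add: field_simps power2_eq_square)
  qed
  moreover have "real q * \<mu> \<le> real q * W / real n"
    using W cM n0 q0 by (simp add: \<mu>_def divide_right_mono mult_left_mono)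
  ultimately have 1: "real q * \<mu> \<le> V" by linarith
  have 2: "a \<le> 2 * V"
  proof -
    have "(2 * real n * \<tau>) * (E * real q) \<le> (E * real q) * (E * real q)"
      using cond(2) E q0 by (intro mult_right_mono) auto
    then show ?thesis using E n0 unfolding V_def a_def
      by (simp add: field_simps power2_eq_square)
  qed
  have 3: "a\<^sup>2 / (4 * V) = \<tau>"
    using E n0 q0 by (simp add: a_def V_def field_simps power2_eq_square)
  have sub: "a \<le> \<bar>real (hits \<pi> {1..q} M) - real q * \<mu>\<bar>"
    if "E < \<bar>real n / real q * (real (hits \<pi> {1..q} {..<v}) - real (hits \<pi> {1..q} {..<?h}))
        - (real v - real ?h)\<bar>" for \<pi>
  proof -
    let ?X = "real (hits \<pi> {1..q} M)"
    have "\<bar>real n / real q * (real (hits \<pi> {1..q} {..<v}) - real (hits \<pi> {1..q} {..<?h}))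
        - (real v - real ?h)\<bar> = \<bar>real n / real q * ?X - real (card M)\<bar>"
    proof (cases "v \<le> ?h")
      case True
      then show ?thesis using hits_lessThan_split[of "{1..q}" v ?h \<pi>] cM
        by (simp add: M_def algebra_simps abs_minus_commute min_def max_def)
    next
      case False
      then show ?thesis using hits_lessThan_split[of "{1..q}" ?h v \<pi>] cM
        by (simp add: M_def algebra_simps min_def max_def)
    qed
    also have "real n / real q * ?X - real (card M) = real n / real q * (?X - real q * \<mu>)"
      using n0 q0 by (simp add: \<mu>_def field_simps)
    also have "\<bar>\<dots>\<bar> = real n / real q * \<bar>?X - real q * \<mu>\<bar>"
      using n0 q0 by (simp add: abs_mult)
    finally show ?thesis using that n0 q0 by (simp add: a_def field_simps)
  qed
  have "measure_pmf.prob (random_order n) {\<pi>. E <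
      \<bar>real n / real q * (real (hits \<pi> {1..q} {..<v}) - real (hits \<pi> {1..q} {..<?h}))
        - (real v - real ?h)\<bar>}
    \<le> measure_pmf.prob (random_order n) {\<pi>. a \<le> \<bar>real (hits \<pi> {1..q} M) - real q * \<mu>\<bar>}"
    using sub by (intro measure_pmf.finite_measure_mono) auto
  also have "\<dots> \<le> 2 * exp (- (a\<^sup>2 / (4 * V)))"
    using prob_hits_deviation[OF M, of "{1..q}" V a] 1 2 V0 a0 q by (simp add: \<mu>_def)
  finally show ?thesis unfolding 3 .
qed

text \<open>A union bound over the at most \<open>n\<close> ranks of the window. The pointwise bound
  is applied with \<open>E / 2\<close>, which turns its constants 4 and 2 into 16 and 4;
  \<open>2 \<le> E\<close> allows rank 0 to be replaced by rank 1, since this changes the deviation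
  by 1.\<close>

lemma prob_fluctuating:
  fixes E W \<tau> :: real
  assumes n: "2 \<le> n" and q: "1 \<le> q" "q \<le> n" and E: "2 \<le> E" "0 < \<tau>"
    and cond: "16 * real n * W * \<tau> \<le> E\<^sup>2 * real q" "4 * real n * \<tau> \<le> E * real q"
  shows "measure_pmf.prob (random_order n) (fluctuating n q W E) \<le> 2 * real n * exp (- \<tau>)"
proof -
  let ?h = "n div 2"
  let ?f = "\<lambda>\<pi> v. real n / real q * (real (hits \<pi> {1..q} {..<v}) - real (hits \<pi> {1..q} {..<?h}))
        - (real v - real ?h)"
  define I where "I = {v \<in> {1..n}. \<bar>real v - real ?h\<bar> \<le> W}"
  have "measure_pmf.prob (random_order n) (fluctuating n q W E)
    \<le> measure_pmf.prob (random_order n) (\<Union>v\<in>I. {\<pi>. E / 2 < \<bar>?f \<pi> v\<bar>})"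
  proof (rule measure_pmf.finite_measure_mono_AE)
    show "AE \<pi> in measure_pmf (random_order n). \<pi> \<in> fluctuating n q W E \<longrightarrow> \<pi> \<in> (\<Union>v\<in>I. {\<pi>. E / 2 < \<bar>?f \<pi> v\<bar>})"
    proof (rule AE_pmfI, rule impI)
      fix \<pi> assume "\<pi> \<in> set_pmf (random_order n)" and bad: "\<pi> \<in> fluctuating n q W E"
      then have perm: "\<pi> permutes {1..n}" by (simp add: set_random_order)
      obtain v where v: "v \<le> n" "\<bar>real v - real ?h\<bar> \<le> W" "E < \<bar>?f \<pi> v\<bar>"
        using bad unfolding fluctuating_def by blast
      show "\<pi> \<in> (\<Union>v\<in>I. {\<pi>. E / 2 < \<bar>?f \<pi> v\<bar>})"
      proof (cases "v = 0")  \<comment> \<open>\<open>{0..<h}\<close> leaves the range of ranks, whence the factor 2 in \<open>E\<close>\<close>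
        case False
        then have "v \<in> I" "E / 2 < \<bar>?f \<pi> v\<bar>" using v E by (auto simp: I_def)
        then show ?thesis by blast
      next
        case True
        have "\<pi> x \<in> {1..n}" if "x \<in> {1..q}" for x
          using that q(2) unfolding permutes_in_image[OF perm] by simp
        then have "{x \<in> {1..q}. \<pi> x \<in> {..<Suc 0}} = {}" by fastforce
        then have h1: "hits \<pi> {1..q} {..<1} = 0" unfolding hits_def One_nat_def by simp
        have h0: "hits \<pi> {1..q} {..<v} = 0" unfolding hits_def True by simp
        have aux: "E / 2 < \<bar>a\<bar>" if "a = b - 1" "E < \<bar>b\<bar>" for a b :: real
          using that E by linarith
        have "?f \<pi> 1 = ?f \<pi> v - 1" unfolding h1 h0 unfolding True by simp
        then have "E / 2 < \<bar>?f \<pi> 1\<bar>" using v(3) by (rule aux)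
        moreover have "1 \<in> I" using v True n by (auto simp: I_def)
        ultimately show ?thesis by blast
      qed
    qed
  qed simp
  also have "\<dots> \<le> (\<Sum>v\<in>I. measure_pmf.prob (random_order n) {\<pi>. E / 2 < \<bar>?f \<pi> v\<bar>})"
    by (intro measure_pmf.finite_measure_subadditive_finite) (auto simp: I_def)
  also have "\<dots> \<le> real (card I) * (2 * exp (- \<tau>))"
  proof (rule sum_bounded_above)
    fix v assume v: "v \<in> I"
    show "measure_pmf.prob (random_order n) {\<pi>. E / 2 < \<bar>?f \<pi> v\<bar>} \<le> 2 * exp (- \<tau>)"
      using v cond E by (intro prob_fluctuation_at[OF n q]) (auto simp: I_def power_divide)
  qed
  also have "\<dots> \<le> real n * (2 * exp (- \<tau>))"
  proof -
    have "I \<subseteq> {1..n}" by (auto simp: I_def)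
    then show ?thesis using card_mono[of "{1..n}" I] by (intro mult_right_mono) simp_all
  qed
  finally show ?thesis by simp
qed

text \<open>All candidates would have to land outside the ranks within \<open>g\<close> of the
  median, and there are at least \<open>g\<close> such ranks unless they are everything.\<close>

lemma prob_avoiding:
  assumes n: "2 \<le> n" and p: "1 \<le> p" "p \<le> n" and g: "0 \<le> g"
  shows "measure_pmf.prob (random_order n) (avoiding n p g) \<le> exp (- (real p * g / real n))"
proof -
  let ?h = "n div 2"
  define I where "I = {i \<in> {1..n}. \<bar>real i - real ?h\<bar> \<le> g}"
  have cI: "card ({1..n} - I) = n - card I" and cIn: "card I \<le> n"
  proof -
    have I: "I \<subseteq> {1..n}" by (auto simp: I_def)
    show "card ({1..n} - I) = n - card I" using card_Diff_subset[OF finite_subset[OF I] I] by simp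
    show "card I \<le> n" using card_mono[OF _ I] by simp
  qed
  have "measure_pmf.prob (random_order n) (avoiding n p g)
    \<le> measure_pmf.prob (random_order n) {\<pi>. \<pi> ` {1..p} \<subseteq> {1..n} - I}"
  proof (rule measure_pmf.finite_measure_mono_AE)
    show "AE \<pi> in measure_pmf (random_order n). \<pi> \<in> avoiding n p g \<longrightarrow> \<pi> \<in> {\<pi>. \<pi> ` {1..p} \<subseteq> {1..n} - I}"
    proof (rule AE_pmfI, rule impI)
      fix \<pi> assume "\<pi> \<in> set_pmf (random_order n)" and av: "\<pi> \<in> avoiding n p g"
      then have perm: "\<pi> permutes {1..n}" by (simp add: set_random_order)
      have "\<pi> x \<in> {1..n} - I" if "x \<in> {1..p}" for x
      proof -
        have "\<pi> x \<in> {1..n}" using that p(2) unfolding permutes_in_image[OF perm] by simp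
        moreover have "g < \<bar>real (\<pi> x) - real ?h\<bar>" using av that unfolding avoiding_def by blast
        then have "\<pi> x \<notin> I" by (simp add: I_def)
        ultimately show ?thesis by blast
      qed
      then show "\<pi> \<in> {\<pi>. \<pi> ` {1..p} \<subseteq> {1..n} - I}" by blast
    qed
  qed simp
  also have "\<dots> \<le> (real (card ({1..n} - I)) / real n) ^ card {1..p}"
    by (rule prob_image_subset_le) (use p in auto)
  also have "\<dots> = (1 - real (card I) / real n) ^ p"
    using cI cIn n by (simp add: of_nat_diff diff_divide_distrib)
  also have "\<dots> \<le> exp (- (real p * g / real n))"
  \<comment> \<open>If \<open>g\<close> exceeds the upper half, no rank can be avoided and the
    probability is 0, although \<open>card I\<close> may be below \<open>g\<close>. Otherwise the
    ranks from the median upwards alone number \<open>\<lfloor>g\<rfloor> + 1\<close>.\<close>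
  proof (cases "real (n - ?h) < g")
    case True
    have "real i - real ?h \<le> g \<and> real ?h - real i \<le> g" if "i \<in> {1..n}" for i
    proof -
      have "real i \<le> real n" "real ?h \<le> real n - real ?h" using that by auto
      moreover have "real (n - ?h) = real n - real ?h" by (simp add: of_nat_diff)
      ultimately show ?thesis using True by auto
    qed
    then have "I = {1..n}" unfolding I_def by (auto simp: abs_le_iff simp del: One_nat_def)
    then show ?thesis using n p by (simp add: power_0_left)
  next
    case False
    let ?k = "nat \<lfloor>g\<rfloor>"
    have k: "real ?k \<le> g" "g < real ?k + 1" using g by linarith+
    have "{?h..?h + ?k} \<subseteq> I"
    proof
      fix i assume i: "i \<in> {?h..?h + ?k}"
      then have "real i - real ?h \<le> g" "real ?h \<le> real i" using k by auto
      moreover have "?k \<le> n - ?h" using False k by linarith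
      ultimately show "i \<in> I" using i n by (auto simp: I_def)
    qed
    then have "card {?h..?h + ?k} \<le> card I" by (intro card_mono) (auto simp: I_def)
    then have "Suc ?k \<le> card I" by simp
    then have "g \<le> real (card I)" using k(2) by linarith
    have "(1 - real (card I) / real n) ^ p \<le> exp (- (real (card I) / real n)) ^ p"
      using exp_ge_add_one_self[of "- (real (card I) / real n)"] cIn n by (intro power_mono) auto
    also have "\<dots> = exp (- (real p * real (card I) / real n))"
      by (simp add: exp_of_nat_mult[symmetric])
    also have "\<dots> \<le> exp (- (real p * g / real n))"
      using \<open>g \<le> real (card I)\<close> by (simp add: divide_right_mono mult_left_mono)
    finally show ?thesis .
  qed
  finally show ?thesis .
qed

text \<open>The exponential bound with exponent 1: the window has at most \<open>2 * (W + 1)\<close>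
  ranks, so the mean is at most \<open>w / 4\<close>, and \<open>exp 1 - 1 \<le> 2\<close> leaves
  \<open>- w / 2\<close>.\<close>

lemma prob_crowded:
  assumes n: "2 \<le> n" and m: "m \<le> n" and W: "0 \<le> W" and cond: "8 * real m * (W + 1) \<le> real w * real n"
  shows "measure_pmf.prob (random_order n) (crowded n m W w) \<le> exp (- real w / 2)"
proof -
  let ?h = "n div 2"
  define I where "I = {i \<in> {1..n}. \<bar>real i - real ?h\<bar> \<le> W}"
  have "I \<subseteq> {?h - nat \<lfloor>W\<rfloor>..?h + nat \<lfloor>W\<rfloor>}"
  proof
    fix i assume "i \<in> I"
    then have "real i - real ?h \<le> W" "real ?h - real i \<le> W" by (auto simp: I_def abs_le_iff)
    then have "int i - int ?h \<le> \<lfloor>W\<rfloor>" "int ?h - int i \<le> \<lfloor>W\<rfloor>" by (simp_all add: le_floor_iff)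
    then show "i \<in> {?h - nat \<lfloor>W\<rfloor>..?h + nat \<lfloor>W\<rfloor>}" by auto
  qed
  then have "card I \<le> card {?h - nat \<lfloor>W\<rfloor>..?h + nat \<lfloor>W\<rfloor>}" by (intro card_mono) auto
  also have "\<dots> \<le> 2 * nat \<lfloor>W\<rfloor> + 1" by simp
  finally have "real (card I) \<le> real (2 * nat \<lfloor>W\<rfloor> + 1)" by (rule of_nat_mono)
  then have cI: "real (card I) \<le> 2 * (W + 1)" using W by simp linarith
  have "measure_pmf.prob (random_order n) (crowded n m W w)
    = measure_pmf.prob (random_order n) {\<pi>. real w \<le> real (hits \<pi> {1..m} I)}"
    by (simp add: crowded_def I_def)
  also have "\<dots> \<le> exp (- 1 * real w + real (card {1..m}) * (real (card I) / real n) * (exp 1 - 1))"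
    by (rule prob_hits_upper) (use m in \<open>auto simp: I_def\<close>)
  also have "\<dots> \<le> exp (- real w / 2)"
  proof -
    have "real m * real (card I) * 4 \<le> real m * (2 * (W + 1)) * 4"
      using cI by (intro mult_right_mono mult_left_mono) auto
    then have "real m * (real (card I) / real n) \<le> real w / 4"
      using cond n by (simp add: field_simps)
    then have "real m * (real (card I) / real n) * (exp 1 - 1) \<le> real w / 4 * 2"
      using exp_le by (intro mult_mono) auto
    moreover have "card {1..m} = m" by simp
    ultimately show ?thesis unfolding exp_le_cancel_iff by (simp only:)
  qed
  finally show ?thesis .
qed

text \<open>Free of \<open>c\<close>: one event about the position of the split controls the
  weighted errors for all exponents at once.\<close>

definition near_split :: "nat \<Rightarrow> real \<Rightarrow> (nat set \<times> nat set) set" where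
  "near_split n b = {({v..n}, {1..<v}) | v. \<bar>real v - real (n div 2)\<bar> \<le> b}"

lemma near_split_mono: "b \<le> b' \<Longrightarrow> near_split n b \<subseteq> near_split n b'"
  unfolding near_split_def by fastforce

lemma weighted_error_near_split:
  assumes "P \<in> near_split n b" "0 \<le> c"
  shows "weighted_error n c P \<le> (b + 1) powr (c + 1)"
proof -
  obtain v where v: "P = ({v..n}, {1..<v})" "\<bar>real v - real (n div 2)\<bar> \<le> b"
    using assms(1) unfolding near_split_def by blast
  have "weighted_error n c P \<le> (\<bar>real v - real (n div 2)\<bar> + 1) powr (c + 1)"
    unfolding v(1) by (rule weighted_error_threshold[OF assms(2)])
  also have "\<dots> \<le> (b + 1) powr (c + 1)"
    using v(2) assms(2) by (intro powr_mono2) auto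
  finally show ?thesis .
qed

lemma outcome_return_pmf:
  "outcome n (return_pmf t) = map_pmf (\<lambda>\<pi>. map_prod (image \<pi>) (image \<pi>) (run \<pi> t)) (random_order n)"
  by (simp add: outcome_def random_order_def pair_return_pmf2 map_pmf_comp)

lemma prob_complement_ge:
  assumes "measure_pmf.prob M B \<le> \<epsilon>" "\<And>x. x \<in> set_pmf M \<Longrightarrow> x \<notin> B \<Longrightarrow> x \<in> A"
  shows "1 - \<epsilon> \<le> measure_pmf.prob M A"
proof -
  have "1 - \<epsilon> \<le> measure_pmf.prob M (- B)"
    using assms(1) measure_pmf.prob_compl[of B M] by (simp add: Compl_eq_Diff_UNIV)
  also have "\<dots> \<le> measure_pmf.prob M A"
    by (rule measure_pmf.finite_measure_mono_AE) (use assms(2) in \<open>auto intro!: AE_pmfI\<close>)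
  finally show ?thesis .
qed

section \<open>From the failure events to the distribution of the output\<close>

context two_round_scheme
begin

abbreviation scheme_outcome :: "(nat set \<times> nat set) pmf" where
  "scheme_outcome \<equiv> outcome n (return_pmf (two_round_tree n p q L m w))"

text \<open>The trivial bound, valid even in failed runs, is what the expected error needs on its
  last tail.\<close>

lemma scheme_outcome_near_split:
  assumes "P \<in> set_pmf scheme_outcome"
  shows "P \<in> near_split n (real n)"
proof -
  obtain \<pi> where pi: "\<pi> \<in> set_pmf (random_order n)"
    "P = map_prod (image \<pi>) (image \<pi>) (run \<pi> (two_round_tree n p q L m w))"
    using assms by (auto simp: outcome_return_pmf)
  interpret two_round_run n L m w p q \<pi>
    using pi(1) by unfold_locales (simp add: set_random_order)
  obtain v where v: "v \<in> V" "P = ({\<pi> v..n}, {1..<\<pi> v})"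
    using run_two_round pi(2) by metis
  have "\<pi> v \<le> n" using v(1) final_pivots_props(1)[of c1] by (intro pi_le) auto
  then have "\<bar>real (\<pi> v) - real (n div 2)\<bar> \<le> real n" by (simp add: abs_le_iff)
  then show ?thesis using v(2) unfolding near_split_def by blast
qed

lemma prob_chain_bad:
  fixes E s \<tau> :: real and g W :: "nat \<Rightarrow> real"
  assumes n: "2 \<le> n" and E: "2 \<le> E" and t: "0 < \<tau>" "2 * real n * exp (- \<tau>) \<le> exp (- s)"
    and cond: "\<And>k. k \<in> {1..L} \<Longrightarrow> 16 * real n * W (k - 1) * \<tau> \<le> E\<^sup>2 * real (q k)"
      "\<And>k. k \<in> {1..L} \<Longrightarrow> 4 * real n * \<tau> \<le> E * real (q k)"
    and g: "\<And>k. k \<in> {1..L} \<Longrightarrow> s * real n \<le> real (p k) * g k" "\<And>k. k \<in> {1..L} \<Longrightarrow> 0 \<le> g k"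
  shows "measure_pmf.prob (random_order n)
      (\<Union>k\<in>{1..L}. fluctuating n (q k) (W (k - 1)) E \<union> avoiding n (p k) (g k)) \<le> 2 * real L * exp (- s)"
proof -
  have "measure_pmf.prob (random_order n)
      (\<Union>k\<in>{1..L}. fluctuating n (q k) (W (k - 1)) E \<union> avoiding n (p k) (g k))
    \<le> (\<Sum>k\<in>{1..L}. measure_pmf.prob (random_order n)
        (fluctuating n (q k) (W (k - 1)) E \<union> avoiding n (p k) (g k)))"
    by (intro measure_pmf.finite_measure_subadditive_finite) auto
  also have "\<dots> \<le> real (card {1..L}) * (2 * exp (- s))"
  proof (rule sum_bounded_above)
    fix k assume k: "k \<in> {1..L}"
    note pq = p_bounds[OF k] q_bounds[OF k]
    have "measure_pmf.prob (random_order n) (fluctuating n (q k) (W (k - 1)) E) \<le> 2 * real n * exp (- \<tau>)"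
      using pq by (intro prob_fluctuating n E t cond k) auto
    moreover have "measure_pmf.prob (random_order n) (avoiding n (p k) (g k)) \<le> exp (- (real (p k) * g k / real n))"
      using pq by (intro prob_avoiding n g k) auto
    moreover have "exp (- (real (p k) * g k / real n)) \<le> exp (- s)"
      using g(1)[OF k] n by (simp add: field_simps)
    moreover have "measure_pmf.prob (random_order n)
        (fluctuating n (q k) (W (k - 1)) E \<union> avoiding n (p k) (g k))
      \<le> measure_pmf.prob (random_order n) (fluctuating n (q k) (W (k - 1)) E)
        + measure_pmf.prob (random_order n) (avoiding n (p k) (g k))"
      by (intro measure_Un_le) auto
    ultimately show "measure_pmf.prob (random_order n)
        (fluctuating n (q k) (W (k - 1)) E \<union> avoiding n (p k) (g k)) \<le> 2 * exp (- s)"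
      using t(2) by linarith
  qed
  finally show ?thesis by simp
qed

text \<open>The first claim relies on the chain alone. The second adds that some fine candidate is
  near the median and that the final window is not crowded with them, at the price of two further
  events of probability at most \<open>exp (- s)\<close>.\<close>

lemma prob_near_split:
  fixes E s \<tau> :: real and g W :: "nat \<Rightarrow> real"
  assumes n: "2 \<le> n" and E: "2 \<le> E" and t: "0 < \<tau>" "2 * real n * exp (- \<tau>) \<le> exp (- s)"
    and W0: "real n \<le> W 0"
    and cond: "\<And>k. k \<in> {1..L} \<Longrightarrow> 16 * real n * W (k - 1) * \<tau> \<le> E\<^sup>2 * real (q k)"
      "\<And>k. k \<in> {1..L} \<Longrightarrow> 4 * real n * \<tau> \<le> E * real (q k)"
    and g: "\<And>k. k \<in> {1..L} \<Longrightarrow> s * real n \<le> real (p k) * g k" "\<And>k. k \<in> {1..L} \<Longrightarrow> 0 \<le> g k"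
    and width: "\<And>k. k \<in> {1..L} \<Longrightarrow> g k + 4 * real L * E + 1 < W (k - 1)"
      "\<And>k. k \<in> {1..L} \<Longrightarrow> g k + 4 * real L * E \<le> W k"
  shows "1 - 2 * real L * exp (- s) \<le> measure_pmf.prob scheme_outcome (near_split n (W L))" (is ?far)
    and "1 \<le> m \<Longrightarrow> s * real n \<le> real m * W L \<Longrightarrow> 0 \<le> s \<Longrightarrow> 2 * s \<le> real w \<Longrightarrow>
      8 * real m * (W L + 1) \<le> real w * real n \<Longrightarrow>
      1 - (2 * real L + 2) * exp (- s) \<le> measure_pmf.prob scheme_outcome (near_split n (s * real n / real m))"
proof -
  let ?B = "\<Union>k\<in>{1..L}. fluctuating n (q k) (W (k - 1)) E \<union> avoiding n (p k) (g k)"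
  let ?h = "real (n div 2)"
  let ?out = "\<lambda>\<pi>. map_prod (image \<pi>) (image \<pi>) (run \<pi> (two_round_tree n p q L m w))"
  have bad: "measure_pmf.prob (random_order n) ?B \<le> 2 * real L * exp (- s)"
    by (rule prob_chain_bad[OF n E t cond g])
  have accurate: "\<bar>real (\<pi> (two_round_run.pivot n L m p q \<pi> L)) - ?h\<bar> \<le> W L"
    if "\<pi> \<in> set_pmf (random_order n)" "\<pi> \<notin> ?B" for \<pi>
  proof -
    interpret two_round_run n L m w p q \<pi>
      using that(1) by unfold_locales (simp add: set_random_order)
    have "\<bar>real n / real (q k) * (real (hits \<pi> {1..q k} {..<v}) - real (hits \<pi> {1..q k} {..<n div 2}))
        - (real v - ?h)\<bar> \<le> E"
      if "k \<in> {1..L}" "v \<le> n" "\<bar>real v - ?h\<bar> \<le> W (k - 1)" for k v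
    proof -
      have "\<pi> \<notin> fluctuating n (q k) (W (k - 1)) E" using \<open>\<pi> \<notin> ?B\<close> that(1) by blast
      then show ?thesis unfolding fluctuating_def using that(2,3) by (simp add: not_less)
    qed
    moreover have "\<exists>y\<in>{1..p k}. \<bar>real (\<pi> y) - ?h\<bar> \<le> g k" if "k \<in> {1..L}" for k
    proof -
      have "\<pi> \<notin> avoiding n (p k) (g k)" using \<open>\<pi> \<notin> ?B\<close> that(1) by blast
      then show ?thesis by (auto simp: avoiding_def not_less)
    qed
    ultimately show ?thesis
      using pivot_chain_accuracy[of E W g L] E W0 width by simp
  qed
  have split: "?out \<pi> \<in> near_split n b"
    if perm: "\<pi> \<in> set_pmf (random_order n)" and y: "y \<in> two_round_run.V n L m w p q \<pi>" "\<bar>real (\<pi> y) - ?h\<bar> \<le> b" for \<pi> y b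
  proof -
    interpret two_round_run n L m w p q \<pi>
      using perm by unfold_locales (simp add: set_random_order)
    obtain v where "\<bar>real (\<pi> v) - ?h\<bar> \<le> \<bar>real (\<pi> y) - ?h\<bar>" "?out \<pi> = ({\<pi> v..n}, {1..<\<pi> v})"
      using run_two_round y(1) by metis
    then show ?thesis using y(2) unfolding near_split_def by fastforce
  qed
  \<comment> \<open>The last pivot always takes part in the second round, so the final choice is at
    least as close to the median.\<close>
  have pivot_V: "two_round_run.pivot n L m p q \<pi> L \<in> two_round_run.V n L m w p q \<pi>" for \<pi>
    by (simp add: final_pivots_def Let_def)
  have "1 - 2 * real L * exp (- s) \<le> measure_pmf.prob (random_order n) (?out -` near_split n (W L))"
    using accurate pivot_V by (intro prob_complement_ge[OF bad]) (blast intro: split)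
  then show ?far by (simp add: outcome_return_pmf)
  assume m: "1 \<le> m" and sm: "s * real n \<le> real m * W L" and s: "0 \<le> s" "2 * s \<le> real w"
    and few: "8 * real m * (W L + 1) \<le> real w * real n"
  \<comment> \<open>Chosen so that \<open>avoiding n m b\<close> has probability at most
    \<open>exp (- s)\<close>; the hypothesis \<open>sm\<close> places this radius inside the window
    of the last pivot.\<close>
  define b where "b = s * real n / real m"
  have b: "0 \<le> b" "b \<le> W L" "real m * b / real n = s"
    using s sm m n by (simp_all add: b_def field_simps)
  let ?B' = "?B \<union> (avoiding n m b \<union> crowded n m (W L) w)"
  have "measure_pmf.prob (random_order n) ?B' \<le> 2 * real L * exp (- s) + (exp (- s) + exp (- s))"
  proof -
    have "measure_pmf.prob (random_order n) (avoiding n m b) \<le> exp (- s)"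
      using prob_avoiding[OF n m m_le b(1)] unfolding b(3) .
    moreover have "measure_pmf.prob (random_order n) (crowded n m (W L) w) \<le> exp (- real w / 2)"
      using b by (intro prob_crowded n m_le few) auto
    moreover have "exp (- real w / 2) \<le> exp (- s)" using s by simp
    moreover have "measure_pmf.prob (random_order n) (avoiding n m b \<union> crowded n m (W L) w)
      \<le> measure_pmf.prob (random_order n) (avoiding n m b) + measure_pmf.prob (random_order n) (crowded n m (W L) w)"
      by (intro measure_Un_le) auto
    ultimately have "measure_pmf.prob (random_order n) (avoiding n m b \<union> crowded n m (W L) w) \<le> exp (- s) + exp (- s)"
      by linarith
    then show ?thesis using bad
      measure_Un_le[of ?B "measure_pmf (random_order n)" "avoiding n m b \<union> crowded n m (W L) w"] by simp
  qed
  also have "\<dots> = (2 * real L + 2) * exp (- s)" by (simp add: algebra_simps)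
  finally have bad': "measure_pmf.prob (random_order n) ?B' \<le> (2 * real L + 2) * exp (- s)" .
  have "1 - (2 * real L + 2) * exp (- s) \<le> measure_pmf.prob (random_order n) (?out -` near_split n b)"
  proof (rule prob_complement_ge[OF bad'])
    fix \<pi> assume pi: "\<pi> \<in> set_pmf (random_order n)" "\<pi> \<notin> ?B'"
    interpret two_round_run n L m w p q \<pi>
      using pi(1) by unfold_locales (simp add: set_random_order)
    have "\<pi> \<notin> avoiding n m b" using pi(2) by blast
    then obtain y where y: "y \<in> {1..m}" "\<bar>real (\<pi> y) - ?h\<bar> \<le> b"
      by (auto simp: avoiding_def not_less)
    have "\<pi> \<notin> crowded n m (W L) w" using pi(2) by blast
    then have "hits \<pi> {1..m} {i \<in> {1..n}. \<bar>real i - ?h\<bar> \<le> W L} < w"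
      by (simp add: crowded_def not_le)
    moreover have "\<bar>real (\<pi> (pivot L)) - ?h\<bar> \<le> W L" using pi by (intro accurate) auto
    ultimately have "y \<in> V" using y b by (intro final_pivots_near[of "W L"]) auto
    then show "\<pi> \<in> ?out -` near_split n b" using split[OF pi(1) _ y(2)] by simp
  qed
  then show "1 - (2 * real L + 2) * exp (- s) \<le> measure_pmf.prob scheme_outcome (near_split n (s * real n / real m))"
    by (simp add: outcome_return_pmf b_def)
qed

end

section \<open>The choice of the parameters\<close>

text \<open>Its power \<open>8 * R\<close> is \<open>sqrt n / l powr (3/2)\<close> with
  \<open>l = ln n\<close>. This total shrinkage takes a window of size \<open>n\<close> down to
  \<open>sqrt n * l powr (3/2)\<close>, the order of the accumulated estimation error.\<close>

definition density_ratio :: "nat \<Rightarrow> nat \<Rightarrow> real" where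
  "density_ratio n R = (sqrt (real n) / ln (real n) powr (3/2)) powr (1 / (8 * real R))"

definition candidates :: "nat \<Rightarrow> nat \<Rightarrow> nat \<Rightarrow> nat" where
  "candidates n R k = nat \<lfloor>density_ratio n R ^ k\<rfloor>"

text \<open>With 24 a level costs at most \<open>n / 24\<close> comparisons, so \<open>8 * R\<close>
  levels cost \<open>R * n / 3\<close>.\<close>

definition sample_size :: "nat \<Rightarrow> nat \<Rightarrow> nat \<Rightarrow> nat" where
  "sample_size n R k = nat \<lfloor>real n / (24 * density_ratio n R ^ k)\<rfloor>"

text \<open>The factor \<open>l powr (3/2)\<close> of the final window is split evenly: the window
  contains of order \<open>l powr (3/4)\<close> fine candidates, and the nearest one is closer to
  the median than the window size by the same order. Dividing by \<open>density_ratio\<close>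
  cancels the extra factor in the window.\<close>

definition fine_candidates :: "nat \<Rightarrow> nat \<Rightarrow> nat" where
  "fine_candidates n R = nat \<lfloor>sqrt (real n) / (density_ratio n R * ln (real n) powr (3/4))\<rfloor>"

definition scheme_tree :: "nat \<Rightarrow> nat \<Rightarrow> comparison_tree" where
  "scheme_tree n R = two_round_tree n (candidates n R) (sample_size n R) (8 * R) (fine_candidates n R) (R div 4)"

section \<open>Elementary bounds on the parameters\<close>

lemma half_le_floor: "1 \<le> x \<Longrightarrow> x / 2 \<le> real (nat \<lfloor>x\<rfloor>)"
proof -
  assume x: "1 \<le> x"
  then have "1 \<le> \<lfloor>x\<rfloor>" by simp
  moreover from this have "real (nat \<lfloor>x\<rfloor>) = real_of_int \<lfloor>x\<rfloor>" by simp
  ultimately show ?thesis by linarith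
qed

locale scheme_parameters =
  fixes n R :: nat
  assumes R: "1 \<le> R" "real R \<le> ln (real n)"
    and ln_large: "16 \<le> ln (real n)"
    and sqrt_large: "24 * ln (real n) powr (3/2) \<le> sqrt (real n)"
begin

abbreviation "l \<equiv> ln (real n)"
abbreviation "\<rho> \<equiv> density_ratio n R"
definition "y = sqrt (real n) / l powr (3/2)"

lemma n_large: "2 \<le> n"
proof (rule ccontr)
  assume "\<not> ?thesis"
  then have "n = 0 \<or> n = 1" by auto
  then show False using ln_large by auto
qed

lemma n_pos: "0 < real n" using n_large by simp

lemma exp_l: "exp l = real n" using n_pos by simp

lemma l_powr: "1 \<le> l powr x" if "0 \<le> x" using that ln_large by (intro ge_one_powr_ge_zero) auto

lemma y: "24 \<le> y" "y \<le> sqrt (real n)"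
proof -
  have "0 < l powr (3/2)" using ln_large by simp
  then show "24 \<le> y" using sqrt_large by (simp add: y_def pos_le_divide_eq)
  have "sqrt (real n) / l powr (3/2) \<le> sqrt (real n) / 1"
    using l_powr[of "3/2"] ln_large by (intro divide_left_mono) auto
  then show "y \<le> sqrt (real n)" by (simp add: y_def)
qed

lemma n_div_y: "real n / y = sqrt (real n) * l powr (3/2)"
  using n_pos by (simp add: y_def field_simps)

text \<open>The last bound carries the gain of using \<open>8 * R\<close> levels: its exponent
  \<open>1 / (16 * R)\<close> is to be compared with the excess \<open>1 / (4 * r + 2)\<close> of
  the target exponent over 1/2.\<close>

lemma ratio: "1 \<le> \<rho>" "\<rho> ^ (8 * R) = y" "\<rho> \<le> y" "\<rho> \<le> real n powr (1 / (16 * real R))"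
proof -
  have rho: "\<rho> = y powr (1 / (8 * real R))" by (simp add: density_ratio_def y_def)
  show 1: "\<rho> \<ge> 1" unfolding rho using y by (intro ge_one_powr_ge_zero) auto
  have "\<rho> ^ (8 * R) = \<rho> powr real (8 * R)" using 1 by (intro powr_realpow[symmetric]) auto
  also have "\<dots> = y" unfolding rho powr_powr using R y by simp
  finally show "\<rho> ^ (8 * R) = y" .
  then show "\<rho> \<le> y" using self_le_power[OF 1, of "8 * R"] R by simp
  have "\<rho> \<le> sqrt (real n) powr (1 / (8 * real R))" unfolding rho using y by (intro powr_mono2) auto
  also have "\<dots> = real n powr (1 / (16 * real R))"
    using n_pos R by (simp add: powr_half_sqrt[symmetric] powr_powr)
  finally show "\<rho> \<le> real n powr (1 / (16 * real R))" .
qed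

lemma ratio_power: "1 \<le> \<rho> ^ k" "k \<le> 8 * R \<Longrightarrow> \<rho> ^ k \<le> y"
proof -
  show "1 \<le> \<rho> ^ k" using ratio(1) by (rule one_le_power)
  show "\<rho> ^ k \<le> y" if "k \<le> 8 * R"
    using power_increasing[OF that ratio(1)] ratio(2) by simp
qed

lemma sqrt_n: "sqrt (real n) \<le> real n" "1 \<le> sqrt (real n)"
  using n_large by (auto intro!: real_sqrt_ge_one simp: sqrt_le_D real_le_lsqrt power2_eq_square)

lemma candidates:
  "\<rho> ^ k / 2 \<le> real (candidates n R k)" "real (candidates n R k) \<le> \<rho> ^ k"
  using ratio_power(1)[of k] half_le_floor[of "\<rho> ^ k"] by (simp_all add: candidates_def)

lemma sample_size:
  assumes "k \<le> 8 * R"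
  shows "real n / (48 * \<rho> ^ k) \<le> real (sample_size n R k)" "real (sample_size n R k) \<le> real n / (24 * \<rho> ^ k)"
    "1 \<le> sample_size n R k"
proof -
  have "24 * \<rho> ^ k \<le> sqrt (real n) * sqrt (real n)"
    using ratio_power[of k] assms y by (intro mult_mono) linarith+
  then have 1: "1 \<le> real n / (24 * \<rho> ^ k)" using ratio_power(1)[of k] by (simp add: field_simps)
  show "real n / (48 * \<rho> ^ k) \<le> real (sample_size n R k)"
    using half_le_floor[OF 1] by (simp add: sample_size_def)
  show "real (sample_size n R k) \<le> real n / (24 * \<rho> ^ k)" "1 \<le> sample_size n R k"
    using 1 by (simp_all add: sample_size_def) (simp add: le_nat_iff le_floor_iff)
qed

lemma fine_candidates:
  "sqrt (real n) / (\<rho> * l powr (3/4)) / 2 \<le> real (fine_candidates n R)"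
  "real (fine_candidates n R) \<le> sqrt (real n) / (\<rho> * l powr (3/4))"
  "1 \<le> fine_candidates n R"
proof -
  have "l powr (3/4) * l powr (3/4) = l powr (3/2)" by (simp add: powr_add[symmetric])
  then have "l powr (3/4) \<le> l powr (3/2)" using l_powr[of "3/4"] mult_right_mono[of 1 "l powr (3/4)" "l powr (3/4)"] by simp
  then have "\<rho> * l powr (3/4) \<le> y * l powr (3/2)"
    using ratio y by (intro mult_mono) auto
  also have "\<dots> = sqrt (real n)" using ln_large by (simp add: y_def)
  finally have 1: "1 \<le> sqrt (real n) / (\<rho> * l powr (3/4))"
    using ratio(1) l_powr[of "3/4"] ln_large by (subst le_divide_eq_1_pos) auto
  show "sqrt (real n) / (\<rho> * l powr (3/4)) / 2 \<le> real (fine_candidates n R)"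
    using half_le_floor[OF 1] by (simp add: fine_candidates_def)
  show "real (fine_candidates n R) \<le> sqrt (real n) / (\<rho> * l powr (3/4))" "1 \<le> fine_candidates n R"
    using 1 by (simp_all add: fine_candidates_def) (simp add: le_nat_iff le_floor_iff)
qed

lemma fine_candidates_le: "real (fine_candidates n R) \<le> sqrt (real n) / l powr (3/4)"
proof -
  have "real (fine_candidates n R) \<le> sqrt (real n) / (\<rho> * l powr (3/4))" by (rule fine_candidates)
  also have "\<dots> \<le> sqrt (real n) / (1 * l powr (3/4))"
    using ratio(1) l_powr[of "3/4"] by (intro divide_left_mono mult_right_mono mult_pos_pos) auto
  finally show ?thesis by simp
qed

sublocale two_round_scheme n "8 * R" "fine_candidates n R" "R div 4" "candidates n R" "sample_size n R"
proof
  show "1 \<le> 8 * R" using R by simp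
  show "1 \<le> candidates n R k \<and> candidates n R k \<le> n" if "k \<in> {1..8 * R}" for k
  proof
    have "0 < real (candidates n R k)" using candidates(1)[of k] ratio_power(1)[of k] by linarith
    then show "1 \<le> candidates n R k" by simp
    have "real (candidates n R k) \<le> real n"
      using candidates(2)[of k] ratio_power(2)[of k] y sqrt_n that by simp
    then show "candidates n R k \<le> n" by simp
  qed
  show "1 \<le> sample_size n R k \<and> sample_size n R k \<le> n" if "k \<in> {1..8 * R}" for k
  proof
    have k: "k \<le> 8 * R" using that by simp
    show "1 \<le> sample_size n R k" by (rule sample_size[OF k])
    have "real n / (24 * \<rho> ^ k) \<le> real n / 1"
      using ratio_power(1)[of k] n_pos by (intro divide_left_mono) auto
    then have "real (sample_size n R k) \<le> real n" using sample_size(2)[OF k] by simp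
    then show "sample_size n R k \<le> n" by simp
  qed
  show "candidates n R j \<le> candidates n R k" if "1 \<le> j" "j \<le> k" "k \<le> 8 * R" for j k
    unfolding candidates_def using that ratio(1)
    by (intro nat_mono floor_mono power_increasing) auto
  have "real (fine_candidates n R) \<le> sqrt (real n) / 1"
    by (rule order_trans[OF fine_candidates_le])
      (use l_powr[of "3/4"] in \<open>intro divide_left_mono, auto\<close>)
  then have "real (fine_candidates n R) \<le> real n" using sqrt_n(1) by simp
  then show "fine_candidates n R \<le> n" by simp
qed

text \<open>The budget is used up exactly by three shares: \<open>R * n / 3\<close> for the levels,
  \<open>R * n / 6\<close> for the fine candidates and \<open>R * n / 2 + n\<close> for the second
  round, where \<open>R div 4\<close> allows at most \<open>R / 2 + 1\<close> pivots.\<close>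

lemma queries_scheme_tree:
  assumes "\<pi> permutes {1..n}"
  shows "real (queries \<pi> (scheme_tree n R)) \<le> (real R + 1) * real n"
proof -
  interpret two_round_run n "8 * R" "fine_candidates n R" "R div 4" "candidates n R" "sample_size n R" \<pi>
    by unfold_locales (rule assms)
  let ?m = "fine_candidates n R"
  have 1: "real (\<Sum>k=1..8*R. sample_size n R k * candidates n R k) \<le> real R * real n / 3"
  proof -
    have "(\<Sum>k=1..8*R. real (sample_size n R k * candidates n R k)) \<le> real (card {1..8*R}) * (real n / 24)"
    proof (rule sum_bounded_above)
      fix k assume "k \<in> {1..8*R}"
      then have k: "k \<le> 8 * R" by simp
      have "real (sample_size n R k) * real (candidates n R k) \<le> real n / (24 * \<rho> ^ k) * \<rho> ^ k"
        using sample_size(2)[OF k] candidates(2)[of k] ratio_power(1)[of k] by (intro mult_mono) auto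
      also have "\<dots> = real n / 24"
        using ratio(1) by simp
      finally show "real (sample_size n R k * candidates n R k) \<le> real n / 24" by simp
    qed
    then show ?thesis by simp
  qed
  have 2: "real (?m * max (candidates n R (8 * R)) ?m) \<le> real R * real n / 6"
  proof -
    have "l powr (3/4) * l powr (3/4) = l powr (3/2)" by (simp add: powr_add[symmetric])
    have "l powr (3/4) \<le> l powr (3/2)" using ln_large by (intro powr_mono) auto
    then have "y \<le> sqrt (real n) / l powr (3/4)"
      unfolding y_def using l_powr[of "3/4"] l_powr[of "3/2"] by (intro divide_left_mono mult_pos_pos) auto
    then have "real (max (candidates n R (8 * R)) ?m) \<le> sqrt (real n) / l powr (3/4)"
      using fine_candidates_le candidates(2)[of "8 * R"] ratio(2) by (simp add: of_nat_max)
    then have "real (?m * max (candidates n R (8 * R)) ?m)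
      \<le> (sqrt (real n) / l powr (3/4)) * (sqrt (real n) / l powr (3/4))"
      unfolding of_nat_mult by (intro mult_mono fine_candidates_le) auto
    also have "\<dots> = real n / l powr (3/2)"
      by (simp add: \<open>l powr (3/4) * l powr (3/4) = l powr (3/2)\<close>)
    also have "\<dots> \<le> real n / 6"
    proof -
      have "6 \<le> l powr 1" using ln_large by simp
      also have "\<dots> \<le> l powr (3/2)" using ln_large by (intro powr_mono) auto
      finally show ?thesis by (intro divide_left_mono) auto
    qed
    also have "\<dots> \<le> real R * real n / 6" using R(1) mult_right_mono[of 1 "real R" "real n"] by simp
    finally show ?thesis .
  qed
  have 3: "real (n * (2 * (R div 4) + 1)) \<le> real R * real n / 2 + real n"
  proof -
    have "2 * real (R div 4) + 1 \<le> real R / 2 + 1" by linarith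
    then have "real n * (2 * real (R div 4) + 1) \<le> real n * (real R / 2 + 1)"
      by (rule mult_left_mono) simp
    then show ?thesis by (simp add: algebra_simps)
  qed
  have "real (queries \<pi> (scheme_tree n R)) \<le>
    real ((\<Sum>k=1..8*R. sample_size n R k * candidates n R k) + ?m * max (candidates n R (8 * R)) ?m + n * (2 * (R div 4) + 1))"
    unfolding scheme_tree_def using queries_two_round by (rule of_nat_mono)
  also have "\<dots> \<le> real R * real n / 3 + real R * real n / 6 + (real R * real n / 2 + real n)"
    using 1 2 3 unfolding of_nat_add by linarith
  also have "\<dots> = (real R + 1) * real n" by (simp add: algebra_simps)
  finally show ?thesis .
qed

lemma partition_algorithm_scheme_tree:
  "partition_algorithm n 2 ((real R + 1) * real n) (return_pmf (scheme_tree n R))"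
  using queries_scheme_tree partition_tree_two_round rounds_two_round
  by (simp add: partition_algorithm_def scheme_tree_def)

abbreviation "out \<equiv> outcome n (return_pmf (scheme_tree n R))"

text \<open>
  \<open>W k = C s \<rho> n / \<rho>\<^sup>k\<close> has to exceed \<open>4 L E\<close>, where \<open>E\<close> is forced to be \<open>48 s \<rho> \<surd>(C l n)\<close>; with
  \<open>L \<le> 8 l\<close> this amounts to \<open>C \<ge> 1536 \<surd>C + 3\<close>, whence \<open>C = 1540\<^sup>2\<close>.
\<close>

lemma prob_out_near_split:
  fixes s :: real
  assumes s: "1 \<le> s"
  defines "b \<equiv> 1540\<^sup>2 * s * \<rho> * sqrt (real n) * l powr (3/2)"
  shows "1 - 16 * real R * exp (- s) \<le> measure_pmf.prob out (near_split n b)"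
    and "4096 * 1540\<^sup>2 * s * l powr (3/4) \<le> real R \<Longrightarrow>
      1 - (16 * real R + 2) * exp (- s) \<le> measure_pmf.prob out (near_split n (2 * s * \<rho> * sqrt (real n) * l powr (3/4)))"
proof -
  \<comment> \<open>Then \<open>exp (- \<tau>)\<close> is \<open>exp (- s)\<close> divided by the
    square of \<open>n\<close>, which pays for the union over \<open>n\<close> ranks and for the
    factor 2.\<close>
  define \<tau> where "\<tau> = 2 * l + s"
  define E where "E = 48 * 1540 * s * \<rho> * sqrt (l * real n)"
  \<comment> \<open>The 2 makes up for rounding: at least \<open>\<rho> ^ k / 2\<close> candidates
    remain.\<close>
  define g where "g k = 2 * s * real n / \<rho> ^ k" for k :: nat
  define W where "W k = 1540\<^sup>2 * s * \<rho> * real n / \<rho> ^ k" for k :: nat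
  let ?q = "sample_size n R" and ?p = "candidates n R" and ?m = "fine_candidates n R"
  have rho: "1 \<le> \<rho>" "0 < \<rho>" using ratio(1) by auto
  have rk: "1 \<le> \<rho> ^ k" "0 < \<rho> ^ k" for k using ratio_power(1)[of k] by linarith+
  have srho: "1 \<le> s * \<rho>" using s rho mult_mono[of 1 s 1 \<rho>] by simp
  have sqrt_ln: "sqrt (l * real n) = sqrt l * sqrt (real n)" by (simp add: real_sqrt_mult)
  have sl: "1 \<le> sqrt l" using ln_large by simp
  have E2: "2 \<le> E"
  proof -
    have "1 \<le> s * \<rho> * (sqrt l * sqrt (real n))"
      using srho sl sqrt_n(2) mult_mono[of 1 "sqrt l" 1 "sqrt (real n)"] mult_mono[of 1 "s * \<rho>" 1 "sqrt l * sqrt (real n)"] by simp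
    then show ?thesis unfolding E_def sqrt_ln by linarith
  qed
  have tau: "0 < \<tau>" "\<tau> \<le> 3 * l * s"
  proof -
    have "0 \<le> (l - 1) * (s - 1)" "0 \<le> (s - 1) * l" using s ln_large by simp_all
    then show "\<tau> \<le> 3 * l * s" using s ln_large by (simp add: \<tau>_def algebra_simps)
  qed (use s ln_large in \<open>simp add: \<tau>_def\<close>)
  have n_tau: "2 * real n * exp (- \<tau>) \<le> exp (- s)"
  proof -
    have "exp (- \<tau>) = exp (- s) * exp (- l) * exp (- l)" by (simp add: \<tau>_def exp_add[symmetric])
    also have "exp (- l) = 1 / real n" by (simp only: exp_minus exp_l) (simp add: field_simps)
    finally have "2 * real n * exp (- \<tau>) = exp (- s) * (2 / real n)" using n_pos by (simp add: field_simps)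
    also have "\<dots> \<le> exp (- s) * 1" using n_large by (intro mult_left_mono) auto
    finally show ?thesis by simp
  qed
  have W0: "real n \<le> W 0"
    using srho n_pos mult_right_mono[of 1 "1540\<^sup>2 * (s * \<rho>)" "real n"] by (simp add: W_def mult_ac)
  have Wpred: "W (k - 1) = \<rho> * W k" if "k \<in> {1..8 * R}" for k
    using that rho by (cases k) (simp_all add: W_def)
  have W_ge: "1540\<^sup>2 * (s * \<rho>) * (sqrt (real n) * l powr (3/2)) \<le> W k" if "k \<le> 8 * R" for k
  proof -
    have "real n / y \<le> real n / \<rho> ^ k"
      using ratio_power(2)[OF that] rk[of k] by (intro divide_left_mono) auto
    then have "1540\<^sup>2 * (s * \<rho>) * (real n / y) \<le> 1540\<^sup>2 * (s * \<rho>) * (real n / \<rho> ^ k)"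
      using srho by (intro mult_left_mono) auto
    then show ?thesis unfolding n_div_y by (simp add: W_def mult_ac)
  qed
  have WL: "W (8 * R) = b"
  proof -
    have "W (8 * R) = 1540\<^sup>2 * s * \<rho> * (real n / y)" by (simp add: W_def ratio(2))
    then show ?thesis unfolding n_div_y by (simp add: b_def mult_ac)
  qed
  have b: "1 \<le> b"
    using mult_mono[of 1 "s * \<rho>" 1 "sqrt (real n) * l powr (3/2)"]
      mult_mono[of 1 "sqrt (real n)" 1 "l powr (3/2)"] srho sqrt_n(2) l_powr[of "3/2"]
    by (simp add: b_def mult_ac)
  have cond1: "16 * real n * W (k - 1) * \<tau> \<le> E\<^sup>2 * real (?q k)" if k: "k \<in> {1..8 * R}" for k
  proof -
    have "16 * real n * W (k - 1) * \<tau> \<le> 16 * real n * W (k - 1) * (3 * l * s)"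
      using tau(2) rho s rk by (intro mult_left_mono) (auto simp: W_def)
    \<comment> \<open>An equality, which is the origin of the 48 in \<open>E\<close>: one factor 48
      is 16 * 3, the 3 coming from the bound on \<open>\<tau>\<close>, and the other is the lower
      bound on the sample size.\<close>
    also have "\<dots> = E\<^sup>2 * (real n / (48 * \<rho> ^ k))"
      unfolding Wpred[OF k] using ln_large rho
      by (simp add: W_def E_def power_mult_distrib power2_eq_square field_simps)
    also have "\<dots> \<le> E\<^sup>2 * real (?q k)" using sample_size(1)[of k] k by (intro mult_left_mono) auto
    finally show ?thesis .
  qed
  have cond2: "4 * real n * \<tau> \<le> E * real (?q k)" if k: "k \<in> {1..8 * R}" for k
  proof -
    \<comment> \<open>The last level has the weakest bound on the sample size, so
      \<open>n / (48 * y)\<close> is used throughout. Here \<open>E\<close> supplies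
      \<open>sqrt l\<close> and \<open>n / y\<close> supplies \<open>l powr (3/2)\<close>; their
      product \<open>l * l\<close> beats the single \<open>l\<close> in
      \<open>\<tau>\<close>.\<close>
    have "sqrt l * l powr (3/2) = l powr (1/2) * l powr (3/2)" using ln_large by (simp add: powr_half_sqrt)
    also have "\<dots> = l powr 2" by (simp add: powr_add[symmetric])
    also have "\<dots> = l * l" using ln_large by (simp add: power2_eq_square)
    finally have ll: "sqrt l * l powr (3/2) = l * l" .
    have "4 * real n * \<tau> \<le> 4 * real n * (3 * l * s)" using tau(2) by (intro mult_left_mono) auto
    also have "\<dots> = (12 * real n * s * l) * 1" by simp
    also have "\<dots> \<le> (12 * real n * s * l) * (1540 * \<rho> * l / 12)"
      using rho ln_large s mult_mono[of 1 \<rho> 1 l] by (intro mult_left_mono) auto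
    also have "\<dots> = 1540 * s * \<rho> * real n * (sqrt l * l powr (3/2))" unfolding ll by simp
    also have "\<dots> = E * (real n / (48 * y))"
    proof -
      have "E * (real n / (48 * y)) = E * (real n / y) / 48" by simp
      also have "\<dots> = 1540 * s * \<rho> * (sqrt (real n) * sqrt (real n)) * (sqrt l * l powr (3/2))"
        unfolding n_div_y E_def sqrt_ln by simp
      finally show ?thesis by simp
    qed
    also have "\<dots> \<le> E * real (?q k)"
    proof (intro mult_left_mono)
      have "real n / (48 * y) \<le> real n / (48 * \<rho> ^ k)"
        using ratio_power(2)[of k] k rk[of k] by (intro divide_left_mono) auto
      then show "real n / (48 * y) \<le> real (?q k)" using sample_size(1)[of k] k by simp
    qed (use E2 in simp)
    finally show ?thesis .
  qed
  have g1: "s * real n \<le> real (?p k) * g k" if "k \<in> {1..8 * R}" for k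
  proof -
    have "s * real n = \<rho> ^ k / 2 * g k" using rho by (simp add: g_def)
    also have "\<dots> \<le> real (?p k) * g k"
      using candidates(1)[of k] s rk[of k] by (intro mult_right_mono) (auto simp: g_def)
    finally show ?thesis .
  qed
  have g0: "0 \<le> g k" for k using s rk[of k] by (simp add: g_def)
  have width2: "g k + 4 * real (8 * R) * E + 1 < W k" if k: "k \<in> {1..8 * R}" for k
  proof -
    define T where "T = s * \<rho> * (real n / \<rho> ^ k)"
    define S where "S = s * \<rho> * (sqrt (real n) * l powr (3/2))"
    have WT: "W k = 1540\<^sup>2 * T" by (simp add: W_def T_def)
    have "S \<le> T" using W_ge[of k] k by (simp add: WT S_def mult_ac)
    have "1 \<le> S"
      using mult_mono[of 1 "s * \<rho>" 1 "sqrt (real n) * l powr (3/2)"]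
        mult_mono[of 1 "sqrt (real n)" 1 "l powr (3/2)"] srho sqrt_n(2) l_powr[of "3/2"]
      by (simp add: S_def)
    have gT: "g k \<le> 2 * T"
    proof -
      have "1 * (2 * s * real n / \<rho> ^ k) \<le> \<rho> * (2 * s * real n / \<rho> ^ k)"
        using rho s rk[of k] by (intro mult_right_mono) auto
      then show ?thesis by (simp add: g_def T_def mult_ac)
    qed
    \<comment> \<open>The cap \<open>R \<le> l\<close> enters here. In units of
      \<open>S \<le> T\<close> the accumulated error takes 1536 * 1540 out of 1540 * 1540, and the
      difference 6160 easily covers \<open>g k\<close> and the rounding unit.\<close>
    have "4 * real (8 * R) * E \<le> 32 * l * E" using R(2) E2 by (simp add: mult_right_mono)
    also have "\<dots> = 1536 * 1540 * (s * \<rho>) * sqrt (real n) * (l * sqrt l)" by (simp add: E_def sqrt_ln)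
    also have "l * sqrt l = l powr 1 * l powr (1/2)" using ln_large by (simp add: powr_half_sqrt)
    also have "\<dots> = l powr (3/2)" unfolding powr_add[symmetric] by simp
    finally have "4 * real (8 * R) * E \<le> 1536 * 1540 * S" by (simp add: S_def mult_ac)
    then have "4 * real (8 * R) * E \<le> 2365440 * S" by simp
    moreover have sq: "(1540::real)\<^sup>2 = 2371600" by simp
    ultimately show ?thesis using gT \<open>S \<le> T\<close> \<open>1 \<le> S\<close> unfolding WT sq by linarith
  qed
  have width1: "g k + 4 * real (8 * R) * E + 1 < W (k - 1)" if k: "k \<in> {1..8 * R}" for k
  proof -
    have "W k \<le> \<rho> * W k" using rho s rk[of k] mult_right_mono[of 1 \<rho> "W k"] by (simp add: W_def)
    then show ?thesis using width2[OF k] Wpred[OF k] by simp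
  qed
  have width3: "g k + 4 * real (8 * R) * E \<le> W k" if k: "k \<in> {1..8 * R}" for k
    using width2[OF k] by simp
  have "1 - 2 * real (8 * R) * exp (- s) \<le> measure_pmf.prob scheme_outcome (near_split n (W (8 * R)))"
    by (rule prob_near_split(1)[OF n_large E2 tau(1) n_tau W0 cond1 cond2 g1 g0 width1 width3])
  then show "1 - 16 * real R * exp (- s) \<le> measure_pmf.prob out (near_split n b)"
    unfolding WL by (simp add: scheme_tree_def)
  assume big: "4096 * 1540\<^sup>2 * s * l powr (3/4) \<le> real R"
  have lp: "1 \<le> l powr (3/4)" by (rule l_powr) simp
  have ll: "l powr (3/2) = l powr (3/4) * l powr (3/4)" by (simp add: powr_add[symmetric])
  have sq: "sqrt (real n) * sqrt (real n) = real n" by simp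
  have m: "1 \<le> ?m" by (rule fine_candidates)
  have mb: "real ?m * b \<le> 1540\<^sup>2 * s * real n * l powr (3/4)"
  proof -
    have "real ?m * b \<le> sqrt (real n) / (\<rho> * l powr (3/4)) * b"
      using fine_candidates(2) b by (intro mult_right_mono) auto
    also have "\<dots> = 1540\<^sup>2 * s * (sqrt (real n) * sqrt (real n)) * l powr (3/4)"
      unfolding b_def ll using rho lp by (simp add: field_simps)
    finally show ?thesis unfolding sq .
  qed
  have mb': "s * real n \<le> real ?m * b"
  proof -
    have "s * real n * 1 \<le> s * real n * (1540\<^sup>2 * l powr (3/4) / 2)"
      using lp s by (intro mult_left_mono) (auto simp: power2_eq_square)
    also have "\<dots> = 1540\<^sup>2 * s * (sqrt (real n) * sqrt (real n)) * l powr (3/4) / 2" unfolding sq by simp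
    also have "\<dots> = sqrt (real n) / (\<rho> * l powr (3/4)) / 2 * b"
      unfolding b_def ll using rho lp by (simp add: field_simps)
    also have "\<dots> \<le> real ?m * b" using fine_candidates(1) b by (intro mult_right_mono) auto
    finally show ?thesis by simp
  qed
  have sR: "4096 * s \<le> real R"
  proof -
    have "4096 * s * 1 \<le> 4096 * s * (1540\<^sup>2 * l powr (3/4))"
      using lp s by (intro mult_left_mono) (auto simp: power2_eq_square)
    then show ?thesis using big by (simp add: mult_ac)
  qed
  have w: "real R / 8 \<le> real (R div 4)" using sR s by linarith
  have few: "8 * real ?m * (b + 1) \<le> real (R div 4) * real n"
  proof -
    have "8 * real ?m * (b + 1) \<le> 8 * real ?m * (2 * b)" using b by (intro mult_left_mono) auto
    also have "\<dots> = 16 * (real ?m * b)" by simp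
    also have "\<dots> \<le> 16 * (1540\<^sup>2 * s * real n * l powr (3/4))" using mb by (rule mult_left_mono) simp
    also have "\<dots> \<le> real R / 8 * real n"
      using mult_right_mono[OF big, of "real n"] s lp n_pos by (simp add: mult_ac)
    also have "\<dots> \<le> real (R div 4) * real n" using w by (intro mult_right_mono) auto
    finally show ?thesis .
  qed
  have "1 - (2 * real (8 * R) + 2) * exp (- s) \<le> measure_pmf.prob out (near_split n (s * real n / real ?m))"
    unfolding scheme_tree_def
    by (rule prob_near_split(2)[OF n_large E2 tau(1) n_tau W0 cond1 cond2 g1 g0 width1 width3])
      (use m mb' few s sR w WL in auto)
  also have "\<dots> \<le> measure_pmf.prob out (near_split n (2 * s * \<rho> * sqrt (real n) * l powr (3/4)))"
  proof (intro measure_pmf.finite_measure_mono near_split_mono)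
    have "0 < sqrt (real n) / (\<rho> * l powr (3/4)) / 2"
      using rho ln_large n_pos by (intro divide_pos_pos mult_pos_pos) auto
    then have "s * real n / real ?m \<le> s * real n / (sqrt (real n) / (\<rho> * l powr (3/4)) / 2)"
      using fine_candidates(1) m s by (intro divide_left_mono mult_pos_pos) auto
    also have "\<dots> = 2 * s * \<rho> * (real n / sqrt (real n)) * l powr (3/4)"
      using rho lp by (simp add: field_simps)
    also have "real n / sqrt (real n) = sqrt (real n)" by (simp add: real_div_sqrt)
    finally show "s * real n / real ?m \<le> 2 * s * \<rho> * sqrt (real n) * l powr (3/4)" .
  qed simp
  finally show "1 - (16 * real R + 2) * exp (- s)
    \<le> measure_pmf.prob out (near_split n (2 * s * \<rho> * sqrt (real n) * l powr (3/4)))" by simp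
qed

end

section \<open>Asymptotics\<close>

text \<open>The base of \<open>error_bound\<close> at \<epsilon> = 0, the scale to be reached
  because \<epsilon> may be arbitrarily small for a given \<open>n\<close>.\<close>

definition error_scale :: "nat \<Rightarrow> nat \<Rightarrow> real" where
  "error_scale n r = 8 * real r * real n powr ((real r + 1) / (2 * real r + 1))"

text \<open>The fallback only concerns small \<open>n\<close>, for which the parameters are meaningless.\<close>

definition partition_alg :: "nat \<Rightarrow> nat \<Rightarrow> randomized_algorithm" where
  "partition_alg r n =
    (let M = return_pmf (scheme_tree n (min r (nat \<lfloor>ln (real n)\<rfloor>)))
     in if partition_algorithm n 2 ((real r + 1) * real n) M then M
        else return_pmf (Output {1..n} {}))"

lemma partition_algorithm_mono:
  "partition_algorithm n d q M \<Longrightarrow> q \<le> q' \<Longrightarrow> partition_algorithm n d q' M"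
  unfolding partition_algorithm_def by force

lemma partition_algorithm_partition_alg:
  "partition_algorithm n 2 ((real r + 1) * real n) (partition_alg r n)"
  by (auto simp: partition_alg_def Let_def partition_algorithm_def)

text \<open>
  The last two conditions serve the regimes \<open>r \<ge> l powr (7/8)\<close>, where the finer candidates
  are needed, and \<open>r < l powr (7/8)\<close>, where the additional levels suffice.
\<close>

definition admissible :: "nat \<Rightarrow> bool" where
  "admissible n \<longleftrightarrow> (let l = ln (real n) in 16 \<le> l \<and> 24 * l powr (3/2) \<le> sqrt (real n) \<and> l powr (7/8) \<le> l - 1 \<and>
    4096 * 1540\<^sup>2 * (l powr (1/32) * l powr (3/4)) \<le> l powr (7/8) \<and>
    1540\<^sup>2 * l powr (3/2) * exp (- (5/48) * l powr (1/8)) \<le> l powr (-1/8))"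

lemma eventually_admissible: "eventually admissible sequentially"
  unfolding admissible_def Let_def by (intro eventually_conj; real_asymp)

text \<open>The exponent is 1/2 plus \<open>1 / (4 * r + 2)\<close>. Besides \<open>sqrt n\<close>
  this isolates the two resources available against \<open>\<rho>\<close> and the logarithms: the
  exponential slack and the factor \<open>r\<close>.\<close>

lemma error_scale_eq:
  assumes "0 < n"
  shows "error_scale n r = 8 * real r * (sqrt (real n) * exp (ln (real n) / (4 * real r + 2)))"
proof -
  have "(real r + 1) / (2 * real r + 1) = 1 / 2 + 1 / (4 * real r + 2)"
    by (simp add: divide_simps) (simp add: algebra_simps)
  then have "real n powr ((real r + 1) / (2 * real r + 1)) = real n powr (1/2) * real n powr (1 / (4 * real r + 2))"
    by (simp add: powr_add)
  moreover have "real n powr (1 / (4 * real r + 2)) = exp (ln (real n) / (4 * real r + 2))"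
    using assms by (simp add: powr_def)
  ultimately show ?thesis using assms by (simp add: error_scale_def powr_half_sqrt)
qed

section \<open>The accuracy of the scheme measured against the error scale\<close>

locale admissible_instance =
  fixes n r :: nat
  assumes adm: "admissible n" and r: "1 \<le> r"
begin

definition "R = min r (nat \<lfloor>ln (real n)\<rfloor>)"

lemmas adm' = adm[unfolded admissible_def Let_def]

sublocale scheme_parameters n R
proof
  have "1 \<le> nat \<lfloor>ln (real n)\<rfloor>" using adm' by linarith
  then show "1 \<le> R" using r by (simp add: R_def)
  have "real (nat \<lfloor>ln (real n)\<rfloor>) \<le> ln (real n)" using adm' by linarith
  then show "real R \<le> ln (real n)" unfolding R_def by linarith
qed (use adm' in auto)

abbreviation "b \<equiv> error_scale n r"

lemma R_le: "R \<le> r" by (simp add: R_def)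

lemma partition_alg_eq: "partition_alg r n = return_pmf (scheme_tree n R)"
proof -
  have "(real R + 1) * real n \<le> (real r + 1) * real n" using R_le by (intro mult_right_mono) auto
  then have "partition_algorithm n 2 ((real r + 1) * real n) (return_pmf (scheme_tree n R))"
    by (rule partition_algorithm_mono[OF partition_algorithm_scheme_tree])
  then show ?thesis by (simp add: partition_alg_def R_def Let_def)
qed

lemma scale_ge: "sqrt (real n) * exp (l / (4 * real r + 2)) * real r = b / 8"
  using n_pos by (simp add: error_scale_eq)

lemma scale_large: "8 \<le> b"
proof -
  have "1 * 1 * 1 \<le> sqrt (real n) * exp (l / (4 * real r + 2)) * real r"
    using sqrt_n ln_large r by (intro mult_mono) auto
  then show ?thesis unfolding scale_ge by simp
qed

lemma ratio_le_exp: "\<rho> \<le> exp (l / (16 * real R))"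
  using ratio(4) n_pos by (simp add: powr_def)

text \<open>Here no cap is active. Since \<open>4 * r + 2 \<le> 6 * r\<close>, the exponents
  \<open>l / (6 * r)\<close> and \<open>l / (16 * r)\<close> differ by
  \<open>(5/48) * (l / r)\<close>, which is at least \<open>(5/48) * l powr (1/8)\<close>; its
  exponential outweighs every power of \<open>l\<close>.\<close>

lemma small_levels:
  assumes "real r < l powr (7/8)"
  shows "1540\<^sup>2 * \<rho> * sqrt (real n) * l powr (3/2) \<le> l powr (-1/8) * b"
proof -
  have "l powr (7/8) \<le> real (nat \<lfloor>l\<rfloor>)" using adm' by linarith
  then have R: "R = r" using assms by (simp add: R_def)
  let ?x = "exp (- (5/48) * l powr (1/8))"
  have "l powr (1/8) * real r \<le> l powr (1/8) * l powr (7/8)" using assms by (intro mult_left_mono) auto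
  also have "\<dots> = l" unfolding powr_add[symmetric] using ln_large by simp
  finally have "l powr (1/8) \<le> l / real r" using r by (simp add: field_simps)
  moreover have "l / (6 * real r) \<le> l / (4 * real r + 2)" using r ln_large by (intro divide_left_mono) auto
  moreover have "l / (16 * real r) = l / (6 * real r) - (5/48) * (l / real r)" using r by (simp add: field_simps)
  ultimately have "l / (16 * real r) \<le> l / (4 * real r + 2) + - (5/48) * l powr (1/8)" by linarith
  then have "\<rho> \<le> exp (l / (4 * real r + 2)) * ?x"
    using ratio_le_exp unfolding R exp_add[symmetric] by (meson exp_le_cancel_iff order_trans)
  then have "sqrt (real n) * \<rho> \<le> sqrt (real n) * (exp (l / (4 * real r + 2)) * ?x)"
    by (intro mult_left_mono) auto
  also have "\<dots> = (sqrt (real n) * exp (l / (4 * real r + 2)) * 1) * ?x" by simp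
  also have "\<dots> \<le> (sqrt (real n) * exp (l / (4 * real r + 2)) * real r) * ?x"
    using r by (intro mult_right_mono mult_left_mono) auto
  also have "\<dots> \<le> b * ?x" unfolding scale_ge using scale_large by (intro mult_right_mono) auto
  finally have "1540\<^sup>2 * l powr (3/2) * (sqrt (real n) * \<rho>) \<le> 1540\<^sup>2 * l powr (3/2) * (b * ?x)"
    by (intro mult_left_mono) auto
  also have "\<dots> = (1540\<^sup>2 * l powr (3/2) * ?x) * b" by (simp only: mult_ac)
  also have "\<dots> \<le> l powr (-1/8) * b" using adm' scale_large by (intro mult_right_mono) auto
  finally show ?thesis by (simp only: mult_ac)
qed

text \<open>Now the factor \<open>r\<close> of the error scale supplies \<open>l powr (7/8)\<close>.
  The ratio costs at most 3 times the exponential slack: without the cap it is below the slack, and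
  with the cap \<open>16 * R \<ge> l\<close> bounds it by \<open>exp 1\<close>.\<close>

lemma many_levels:
  assumes "l powr (7/8) \<le> real r"
  shows "l powr (7/8) \<le> real R" "l powr (7/8) * (\<rho> * sqrt (real n)) \<le> 3/8 * b"
proof -
  have "l powr (7/8) \<le> real (nat \<lfloor>l\<rfloor>)" using adm' by linarith
  then show "l powr (7/8) \<le> real R" using assms unfolding R_def by linarith
  have "\<rho> \<le> 3 * exp (l / (4 * real r + 2))"
  proof (cases "R = r")
    case True
    have "l / (16 * real r) \<le> l / (4 * real r + 2)" using r ln_large by (intro divide_left_mono) auto
    then have "exp (l / (16 * real r)) \<le> exp (l / (4 * real r + 2))" by simp
    moreover have "0 \<le> exp (l / (4 * real r + 2))" by simp
    ultimately show ?thesis using ratio_le_exp unfolding True by linarith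
  next
    case False
    then have "R = nat \<lfloor>l\<rfloor>" by (auto simp: R_def)
    then have "l \<le> 16 * real R" using ln_large by linarith
    then have "l / (16 * real R) \<le> 1" using R by simp
    then have "exp (l / (16 * real R)) \<le> exp 1" unfolding exp_le_cancel_iff .
    then have "\<rho> \<le> 3 * 1" using ratio_le_exp exp_le by linarith
    also have "\<dots> \<le> 3 * exp (l / (4 * real r + 2))" using ln_large by (intro mult_left_mono) auto
    finally show ?thesis .
  qed
  then have "l powr (7/8) * (\<rho> * sqrt (real n)) \<le> real r * (3 * exp (l / (4 * real r + 2)) * sqrt (real n))"
    using assms ratio(1) by (intro mult_mono) auto
  also have "\<dots> = 3 * (sqrt (real n) * exp (l / (4 * real r + 2)) * real r)" by simp
  finally show "l powr (7/8) * (\<rho> * sqrt (real n)) \<le> 3/8 * b" unfolding scale_ge by simp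
qed

text \<open>Valid for arbitrarily large \<open>s\<close>, at the loss of a factor \<open>l\<close>.
  The 18 is 16 + 2, so that the failure bound matches that of \<open>prob_fine\<close>.\<close>

lemma prob_coarse:
  assumes s: "1 \<le> s"
  shows "1 - 18 * real R * exp (- s) \<le> measure_pmf.prob out (near_split n (1540\<^sup>2 * s * l * b))"
proof -
  have lb: "l powr (-1/8) \<le> l" using powr_mono[of "-1/8" 1 l] ln_large by simp
  have "\<rho> * sqrt (real n) * l powr (3/2) \<le> l * b"
  proof (cases "real r < l powr (7/8)")
    case True
    have "1 * (\<rho> * sqrt (real n) * l powr (3/2)) \<le> 1540\<^sup>2 * (\<rho> * sqrt (real n) * l powr (3/2))"
      using ratio(1) by (intro mult_right_mono) (auto simp: power2_eq_square)
    also have "\<dots> \<le> l powr (-1/8) * b" using small_levels[OF True] by (simp only: mult_ac)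
    also have "\<dots> \<le> l * b" using lb scale_large by (intro mult_right_mono) auto
    finally show ?thesis by simp
  next
    case False
    have "l powr (3/2) = l powr (5/8) * l powr (7/8)" unfolding powr_add[symmetric] by simp
    then have "\<rho> * sqrt (real n) * l powr (3/2) = l powr (5/8) * (l powr (7/8) * (\<rho> * sqrt (real n)))" by simp
    also have "\<dots> \<le> l powr 1 * b"
      using many_levels(2) False scale_large ln_large ratio(1) by (intro mult_mono powr_mono) auto
    finally show ?thesis using ln_large by simp
  qed
  then have "(1540\<^sup>2 * s) * (\<rho> * sqrt (real n) * l powr (3/2)) \<le> (1540\<^sup>2 * s) * (l * b)"
    using s by (intro mult_left_mono) auto
  then have "near_split n (1540\<^sup>2 * s * \<rho> * sqrt (real n) * l powr (3/2)) \<subseteq> near_split n (1540\<^sup>2 * s * l * b)"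
    by (intro near_split_mono) (simp only: mult.assoc)
  then have "measure_pmf.prob out (near_split n (1540\<^sup>2 * s * \<rho> * sqrt (real n) * l powr (3/2)))
    \<le> measure_pmf.prob out (near_split n (1540\<^sup>2 * s * l * b))"
    by (intro measure_pmf.finite_measure_mono) auto
  moreover have "16 * real R * exp (- s) \<le> 18 * real R * exp (- s)" by (intro mult_right_mono) auto
  ultimately show ?thesis using prob_out_near_split(1)[OF s] by linarith
qed

text \<open>Gains \<open>l powr (-1/8)\<close> over the error scale, but only for small
  \<open>s\<close>: with many levels the second round must afford a constant times
  \<open>s * l powr (3/4)\<close> pivots, and only \<open>R \<ge> l powr (7/8)\<close> is
  known.\<close>

lemma prob_fine:
  assumes s: "1 \<le> s" "s \<le> l powr (1/32)"
  shows "1 - 18 * real R * exp (- s) \<le> measure_pmf.prob out (near_split n (s * l powr (-1/8) * b))"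
proof (cases "real r < l powr (7/8)")
  case True
  have "s * (1540\<^sup>2 * \<rho> * sqrt (real n) * l powr (3/2)) \<le> s * (l powr (-1/8) * b)"
    using small_levels[OF True] s by (intro mult_left_mono) auto
  then have "near_split n (1540\<^sup>2 * s * \<rho> * sqrt (real n) * l powr (3/2)) \<subseteq> near_split n (s * l powr (-1/8) * b)"
    by (intro near_split_mono) (simp only: mult_ac)
  then have "measure_pmf.prob out (near_split n (1540\<^sup>2 * s * \<rho> * sqrt (real n) * l powr (3/2)))
    \<le> measure_pmf.prob out (near_split n (s * l powr (-1/8) * b))"
    by (intro measure_pmf.finite_measure_mono) auto
  moreover have "16 * real R * exp (- s) \<le> 18 * real R * exp (- s)" by (intro mult_right_mono) auto
  ultimately show ?thesis using prob_out_near_split(1)[OF s(1)] by linarith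
next
  case False
  then have r7: "l powr (7/8) \<le> real r" by simp
  have "4096 * 1540\<^sup>2 * s * l powr (3/4) = 4096 * 1540\<^sup>2 * (s * l powr (3/4))" by simp
  also have "\<dots> \<le> 4096 * 1540\<^sup>2 * (l powr (1/32) * l powr (3/4))"
    using s by (intro mult_left_mono mult_right_mono) auto
  also have "\<dots> \<le> l powr (7/8)" using adm' by blast
  also have "\<dots> \<le> real R" by (rule many_levels[OF r7])
  finally have big: "4096 * 1540\<^sup>2 * s * l powr (3/4) \<le> real R" .
  have "l powr (3/4) = l powr (-1/8) * l powr (7/8)" unfolding powr_add[symmetric] by simp
  then have "2 * s * \<rho> * sqrt (real n) * l powr (3/4) = 2 * s * l powr (-1/8) * (l powr (7/8) * (\<rho> * sqrt (real n)))"
    by simp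
  also have "\<dots> \<le> 2 * s * l powr (-1/8) * (3/8 * b)"
    using many_levels(2)[OF r7] s by (intro mult_left_mono) auto
  also have "\<dots> \<le> s * l powr (-1/8) * b" using s scale_large by simp
  finally have "measure_pmf.prob out (near_split n (2 * s * \<rho> * sqrt (real n) * l powr (3/4)))
    \<le> measure_pmf.prob out (near_split n (s * l powr (-1/8) * b))"
    by (intro measure_pmf.finite_measure_mono near_split_mono) auto
  moreover have "(16 * real R + 2) * exp (- s) \<le> 18 * real R * exp (- s)"
    using R(1) by (intro mult_right_mono) auto
  ultimately show ?thesis using prob_out_near_split(2)[OF s(1) big] by linarith
qed

lemma prob_error_ge:
  assumes "(B + 1) powr (c + 1) \<le> \<beta>" "0 \<le> c"
  shows "measure_pmf.prob out (near_split n B) \<le> prob_error_le n c (partition_alg r n) \<beta>"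
  unfolding prob_error_le_def partition_alg_eq
  using weighted_error_near_split[of _ n B c] assms
  by (intro measure_pmf.finite_measure_mono) (auto intro: order_trans)

end

text \<open>Uniformity in \<epsilon> forces a case split on \<open>s\<close> against
  \<open>l powr (1/32)\<close>. If \<open>s\<close> is small, the factor gained by
  \<open>prob_fine\<close> absorbs it even when \<open>t\<close> is close to 1. If \<open>s\<close>
  is large, logarithms are bounded by powers of \<open>t\<close>, and \<open>prob_coarse\<close>
  suffices.\<close>

lemma prob_error_bound:
  "\<forall>\<^sub>F n in sequentially. \<forall>r\<ge>1. \<forall>\<epsilon>>0. \<forall>c\<ge>0.
    prob_error_le n c (partition_alg r n) (error_bound n c r \<epsilon>)
      \<ge> 1 - real r * exp (- (real n powr ((1 / 34) * \<epsilon>)))"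
proof -
  have "\<forall>\<^sub>F n in sequentially. 12 * ln (real n) powr (-1/8) \<le> 1"
    "\<forall>\<^sub>F n in sequentially. 2 * 1540\<^sup>2 * 6 ^ 34 \<le> ln (real n) powr (1/32)"
    by real_asymp+
  with eventually_admissible show ?thesis
  proof eventually_elim
    case (elim n)
    show ?case
    proof (intro allI impI)
      fix r :: nat and \<epsilon> c :: real
      assume r: "1 \<le> r" and eps: "0 < \<epsilon>" and c: "0 \<le> c"
      interpret admissible_instance n r using elim(1) r by unfold_locales
      \<comment> \<open>34 = 1 + 32 + 1: in the coarse case \<open>s\<close> costs one power of
        \<open>t\<close>, \<open>l \<le> (6 * t) ^ 32\<close> costs 32, and one more absorbs the
        constants.\<close>
      define t where "t = real n powr (\<epsilon> / 34)"
      have t: "1 \<le> t" unfolding t_def using n_large eps by (intro ge_one_powr_ge_zero) auto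
      have t34: "t ^ 34 = real n powr \<epsilon>"
        using n_pos by (simp add: t_def powr_power)
      \<comment> \<open>The 5 removes the prefactor: \<open>18 * exp (-5) \<le> 1\<close>.\<close>
      define s where "s = t + 5"
      have s: "1 \<le> s" "s \<le> 6 * t" using t by (auto simp: s_def)
      have t1: "t \<le> t ^ 34" using self_le_power[OF t, of 34] by simp
      have b0: "0 \<le> b" using scale_large by simp
      obtain B where B: "1 - 18 * real R * exp (- s) \<le> measure_pmf.prob out (near_split n B)" "B \<le> b * t ^ 34 / 2" "0 \<le> B"
      proof (cases "s \<le> l powr (1/32)")
        case True
        have "s * l powr (-1/8) * b \<le> 6 * t * l powr (-1/8) * b"
          using s b0 by (intro mult_right_mono) auto
        also have "\<dots> = (12 * l powr (-1/8)) * (t * b / 2)" by simp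
        also have "\<dots> \<le> 1 * (t * b / 2)" using elim(2) t b0 by (intro mult_right_mono) auto
        also have "\<dots> \<le> b * t ^ 34 / 2" using t1 mult_right_mono[OF t1 b0] by (simp add: mult.commute)
        finally show ?thesis using that[OF prob_fine[OF s(1) True]] s b0 by simp
      next
        case False
        then have lt: "l powr (1/32) \<le> 6 * t" using s by linarith
        have "l = (l powr (1/32)) ^ 32" using ln_large by (simp add: powr_power)
        also have "\<dots> \<le> (6 * t) ^ 32" using lt by (intro power_mono) auto
        finally have l: "l \<le> (6 * t) ^ 32" .
        have "2 * 1540\<^sup>2 * 6 ^ 34 \<le> 6 * t" using elim(3) lt by linarith
        then have tb: "1540\<^sup>2 * 6 ^ 33 \<le> t / 2" by simp
        have "1540\<^sup>2 * s * l * b \<le> 1540\<^sup>2 * (6 * t) * (6 * t) ^ 32 * b"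
          using s l b0 ln_large by (intro mult_right_mono mult_mono) auto
        also have "\<dots> = (1540\<^sup>2 * 6 ^ 33) * t ^ 33 * b" by (simp add: power_mult_distrib flip: power_Suc)
        also have "\<dots> \<le> (t / 2) * t ^ 33 * b" using tb b0 t by (intro mult_right_mono) auto
        also have "\<dots> = b * t ^ 34 / 2" by (simp flip: power_Suc)
        finally show ?thesis using that[OF prob_coarse[OF s(1)]] s b0 ln_large by simp
      qed
      have "1 \<le> t ^ 34" using t by (rule one_le_power)
      then have "1 \<le> b * t ^ 34 / 2" using mult_mono[of 8 b 1 "t ^ 34"] scale_large by simp
      then have "B + 1 \<le> b * t ^ 34" using B(2) by linarith
      also have "\<dots> = 8 * real r * real n powr ((real r + 1) / (2 * real r + 1) + \<epsilon>)"
        by (simp add: t34 error_scale_def powr_add)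
      finally have "(B + 1) powr (c + 1) \<le> error_bound n c r \<epsilon>"
        unfolding error_bound_def using B(3) c by (intro powr_mono2) auto
      then have "measure_pmf.prob out (near_split n B) \<le> prob_error_le n c (partition_alg r n) (error_bound n c r \<epsilon>)"
        by (rule prob_error_ge) (rule c)
      moreover have "18 * real R * exp (- s) \<le> real r * exp (- t)"
      proof -
        have "(2::real) ^ 5 \<le> exp 1 ^ 5" using exp_ge_add_one_self[of 1] by (intro power_mono) auto
        also have "\<dots> = exp 5" by (simp flip: exp_of_nat_mult)
        finally have "18 * exp (-5) \<le> (1::real)" by (simp add: exp_minus field_simps)
        then have "real R * (18 * exp (-5)) * exp (- t) \<le> real r * 1 * exp (- t)"
          using R_le by (intro mult_right_mono mult_mono) auto
        moreover have "exp (- s) = exp (-5) * exp (- t)" by (simp add: s_def flip: exp_add)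
        ultimately show ?thesis by simp
      qed
      ultimately show "1 - real r * exp (- (real n powr ((1 / 34) * \<epsilon>)))
          \<le> prob_error_le n c (partition_alg r n) (error_bound n c r \<epsilon>)"
        using B(1) by (simp add: t_def)
    qed
  qed
qed

text \<open>Proved at \<epsilon> = 0 by three tiers contributing 1/2, 1/4 and 1/4 of the target:
  typically the fine bound holds, its failures are paid by the coarse bound, and failures of that by
  the trivial distance \<open>n\<close>.\<close>

lemma expected_error_bound:
  assumes c: "0 \<le> c"
  shows "\<forall>\<^sub>F n in sequentially. \<forall>r\<ge>1. \<forall>\<epsilon>>0.
    expected_error n c (partition_alg r n) \<le> error_bound n c r \<epsilon>"
proof -
  \<comment> \<open>\<open>K\<close> and \<open>d\<close> collect the constants and the powers of
    \<open>ln n\<close> in the middle tier; the 1 in \<open>d\<close> is the factor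
    \<open>R \<le> l\<close> of the failure probability.\<close>
  define K where "K = (2 * 1540\<^sup>2 * (c + 2)) powr (c + 1) * 18"
  define d where "d = 2 * (c + 1) + 1"
  have K: "0 < K" using c by (simp add: K_def)
  have "\<forall>\<^sub>F n in sequentially. 4 * ln (real n) powr (-3/32) \<le> 1"
    by real_asymp
  moreover have "\<forall>\<^sub>F n in sequentially. K * ln (real n) powr d * exp (- (ln (real n) powr (1/32))) \<le> 1 / 4"
  proof -
    have "(\<lambda>n. K * ln (real n) powr d * exp (- (ln (real n) powr (1/32)))) \<longlonglongrightarrow> 0"
      by real_asymp
    then have "\<forall>\<^sub>F n in sequentially. K * ln (real n) powr d * exp (- (ln (real n) powr (1/32))) < 1 / 4" by (rule order_tendstoD) simp
    then show ?thesis by eventually_elim simp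
  qed
  moreover have "\<forall>\<^sub>F n in sequentially. 2 powr (c + 1) * 18 * ln (real n) / real n \<le> 1 / 4"
  proof -
    have "(\<lambda>n. 2 powr (c + 1) * 18 * ln (real n) / real n) \<longlonglongrightarrow> 0"
      by real_asymp
    then have "\<forall>\<^sub>F n in sequentially. 2 powr (c + 1) * 18 * ln (real n) / real n < 1 / 4" by (rule order_tendstoD) simp
    then show ?thesis by eventually_elim simp
  qed
  ultimately show ?thesis using eventually_admissible
  proof eventually_elim
    case (elim n)
    show ?case
    proof (intro allI impI)
      fix r :: nat and \<epsilon> :: real
      assume r: "1 \<le> r" and eps: "0 < \<epsilon>"
      interpret admissible_instance n r using elim(4) r by unfold_locales
      \<comment> \<open>The largest value that \<open>prob_fine\<close> admits. Its failure
        probability beats every power of \<open>l\<close>, hence the polylogarithmic loss of the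
        coarse bound.\<close>
      define s0 where "s0 = l powr (1/32)"
      \<comment> \<open>Makes \<open>exp (- s1)\<close> equal to \<open>n powr (- (c + 2))\<close>:
        \<open>c + 1\<close> powers cancel the trivial error and one is left to absorb
        \<open>l\<close>.\<close>
      define s1 where "s1 = (c + 2) * l"
      define B0 where "B0 = s0 * l powr (-1/8) * b"
      define B1 where "B1 = 1540\<^sup>2 * s1 * l * b"
      have s: "1 \<le> s0" "1 \<le> s1"
        using l_powr[of "1/32"] ln_large c mult_mono[of 1 "c + 2" 1 l] by (simp_all add: s0_def s1_def)
      have bpos: "8 \<le> b" by (rule scale_large)
      have B0: "0 \<le> B0" "B0 + 1 \<le> b / 2"
      proof -
        have "s0 * l powr (-1/8) = l powr (-3/32)" unfolding s0_def powr_add[symmetric] by simp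
        then have "B0 = (4 * l powr (-3/32)) * (b / 4)" by (simp add: B0_def)
        also have "\<dots> \<le> 1 * (b / 4)" using elim(1) bpos by (intro mult_right_mono) auto
        finally show "B0 + 1 \<le> b / 2" using bpos by simp
        show "0 \<le> B0" using s bpos by (simp add: B0_def)
      qed
      have B1: "0 \<le> B1" "B1 + 1 \<le> 2 * 1540\<^sup>2 * (c + 2) * l powr 2 * b"
      proof -
        have "1 * 1 \<le> s1 * (l * b)" using s ln_large bpos mult_mono[of 1 l 1 b] by (intro mult_mono) auto
        then have "1 \<le> B1" by (simp add: B1_def mult_ac)
        moreover have "2 * 1540\<^sup>2 * (c + 2) * l powr 2 * b = 2 * B1"
          using ln_large by (simp add: B1_def s1_def power2_eq_square)
        ultimately show "0 \<le> B1" "B1 + 1 \<le> 2 * 1540\<^sup>2 * (c + 2) * l powr 2 * b" by linarith+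
      qed
      let ?w = "weighted_error n c"
      let ?N0 = "near_split n B0" and ?N1 = "near_split n B1"
      let ?g = "\<lambda>P. (B0 + 1) powr (c + 1) + (B1 + 1) powr (c + 1) * indicator (- ?N0) P
        + (real n + 1) powr (c + 1) * indicator (- ?N1) P"
      have fin: "finite (set_pmf out)"
        by (simp add: outcome_return_pmf finite_set_random_order)
      have int: "integrable (measure_pmf out) f" for f :: "_ \<Rightarrow> real"
        by (rule integrable_measure_pmf_finite[OF fin])
      have "expected_error n c (partition_alg r n) \<le> measure_pmf.expectation out ?g"
        unfolding expected_error_def partition_alg_eq
      proof (rule integral_mono_AE[OF int int], rule AE_pmfI)
        fix P assume P: "P \<in> set_pmf out"
        have top: "?w P \<le> (real n + 1) powr (c + 1)"
          using scheme_outcome_near_split P c unfolding scheme_tree_def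
          by (intro weighted_error_near_split) auto
        have nonneg: "0 \<le> (B1 + 1) powr (c + 1) * indicator (- ?N0) P"
          "0 \<le> (real n + 1) powr (c + 1) * indicator (- ?N1) P" "0 \<le> (B0 + 1) powr (c + 1)"
          by simp_all
        consider "P \<in> ?N0" | "P \<notin> ?N0" "P \<in> ?N1" | "P \<notin> ?N1" by blast
        then show "?w P \<le> ?g P"
        proof cases
          case 1
          then have "?w P \<le> (B0 + 1) powr (c + 1)" using c by (rule weighted_error_near_split)
          then show ?thesis using nonneg by linarith
        next
          case 2
          have "?w P \<le> (B1 + 1) powr (c + 1) * indicator (- ?N0) P"
            using weighted_error_near_split[OF 2(2) c] 2(1) by simp
          then show ?thesis using nonneg by linarith
        next
          case 3
          then have "?w P \<le> (real n + 1) powr (c + 1) * indicator (- ?N1) P" using top by simp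
          then show ?thesis using nonneg by linarith
        qed
      qed
      also have "\<dots> = (B0 + 1) powr (c + 1) + (B1 + 1) powr (c + 1) * measure_pmf.prob out (- ?N0)
        + (real n + 1) powr (c + 1) * measure_pmf.prob out (- ?N1)"
        by (simp add: int)
      also have "\<dots> \<le> b powr (c + 1) / 2 + b powr (c + 1) / 4 + b powr (c + 1) / 4"
      proof (intro add_mono)
        have b1: "b \<le> b powr (c + 1)" using powr_mono[of 1 "c + 1" b] c bpos by simp
        have "(B0 + 1) powr (c + 1) \<le> (b / 2) powr (c + 1)" using B0 c by (intro powr_mono2) auto
        also have "\<dots> = b powr (c + 1) / 2 powr (c + 1)" using bpos by (simp add: powr_divide)
        also have "\<dots> \<le> b powr (c + 1) / 2 powr 1"
          using c by (intro divide_left_mono powr_mono) auto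
        finally show "(B0 + 1) powr (c + 1) \<le> b powr (c + 1) / 2" by simp
        have compl: "measure_pmf.prob out (- A) = 1 - measure_pmf.prob out A" for A
          using measure_pmf.prob_compl[of A out] by (simp add: Compl_eq_Diff_UNIV)
        have Rl: "18 * real R * exp (- s) \<le> 18 * l * exp (- s)" for s
          using R(2) by (intro mult_right_mono) auto
        have p: "measure_pmf.prob out (- ?N0) \<le> 18 * l * exp (- s0)"
          "measure_pmf.prob out (- ?N1) \<le> 18 * l * exp (- s1)"
          using prob_fine[OF s(1) eq_refl[OF s0_def]] prob_coarse[OF s(2)] Rl[of s0] Rl[of s1]
          unfolding compl B0_def[symmetric] B1_def[symmetric] by linarith+
        have "(B1 + 1) powr (c + 1) * measure_pmf.prob out (- ?N0)
          \<le> (2 * 1540\<^sup>2 * (c + 2) * l powr 2 * b) powr (c + 1) * (18 * l * exp (- s0))"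
          using B1 p c by (intro mult_mono powr_mono2) auto
        also have "\<dots> = (K * l powr d * exp (- s0)) * b powr (c + 1)"
        proof -
          have "(2 * 1540\<^sup>2 * (c + 2) * l powr 2 * b) powr (c + 1)
            = (2 * 1540\<^sup>2 * (c + 2)) powr (c + 1) * l powr (2 * (c + 1)) * b powr (c + 1)"
            using c bpos by (subst powr_mult, simp, simp, subst powr_mult, simp, simp) (simp add: powr_powr)
          moreover have "l powr d = l powr (2 * (c + 1)) * l"
            unfolding d_def powr_add[of l "2 * (c + 1)" 1] using ln_large by simp
          ultimately show ?thesis by (simp add: K_def)
        qed
        also have "\<dots> \<le> 1 / 4 * b powr (c + 1)" using elim(2) by (intro mult_right_mono) (auto simp: s0_def)
        finally show "(B1 + 1) powr (c + 1) * measure_pmf.prob out (- ?N0) \<le> b powr (c + 1) / 4" by simp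
        have "(real n + 1) powr (c + 1) * measure_pmf.prob out (- ?N1)
          \<le> (2 * real n) powr (c + 1) * (18 * l * exp (- s1))"
          using p c n_large by (intro mult_mono powr_mono2) auto
        also have "exp (- s1) = real n powr (- (c + 1)) / real n"
        proof -
          have "exp (- s1) = real n powr (- (c + 1) - 1)"
            using n_pos by (simp add: s1_def powr_def algebra_simps)
          then show ?thesis using n_pos by (simp only: powr_diff) simp
        qed
        also have "(2 * real n) powr (c + 1) * (18 * l * (real n powr (- (c + 1)) / real n))
          = 2 powr (c + 1) * 18 * l / real n"
        proof -
          have "real n powr (c + 1) * real n powr (- (c + 1)) = 1"
            unfolding powr_add[symmetric] using n_pos by simp
          moreover have "(2 * real n) powr (c + 1) = 2 powr (c + 1) * real n powr (c + 1)"
            by (simp add: powr_mult)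
          ultimately show ?thesis by (simp add: mult_ac)
        qed
        also have "\<dots> \<le> 1 / 4" by (rule elim(3))
        also have "\<dots> \<le> b powr (c + 1) / 4" using b1 bpos by simp
        finally show "(real n + 1) powr (c + 1) * measure_pmf.prob out (- ?N1) \<le> b powr (c + 1) / 4" .
      qed
      also have "\<dots> = b powr (c + 1)" by simp
      also have "\<dots> \<le> error_bound n c r \<epsilon>"
        unfolding error_bound_def error_scale_def using c eps n_large
        by (intro powr_mono2 mult_left_mono powr_mono) auto
      finally show "expected_error n c (partition_alg r n) \<le> error_bound n c r \<epsilon>" .
    qed
  qed
qed

text \<open>At \<open>r = \<lfloor>l\<rfloor>\<close> the exponential slack is at most 3, so the
  error scale is at most \<open>24 * l * sqrt n\<close>. The coarse bound with
  \<open>s = 3 * l\<close> then gives \<open>72 * 1540\<^sup>2 * l ^ 3 * sqrt n\<close>, and the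
  fourth power of \<open>l\<close> absorbs the constant; the failure probability is of order
  \<open>l / n ^ 3\<close>.\<close>

lemma prob_error_log_rounds:
  assumes c: "0 \<le> c"
  shows "(\<lambda>n. 1 - prob_error_le n c (partition_alg (nat \<lfloor>ln (real n)\<rfloor>) n)
      ((sqrt (real n) * ln (real n) ^ 4) powr (c + 1))) \<in> O(\<lambda>n. ln (real n) / real n ^ 2)"
proof (rule bigoI[where c = 18])
  have "\<forall>\<^sub>F n in sequentially. 72 * 1540\<^sup>2 * ln (real n) ^ 3 * sqrt (real n) + 1 \<le> sqrt (real n) * ln (real n) ^ 4"
    by real_asymp
  with eventually_admissible show "\<forall>\<^sub>F n in sequentially.
      norm (1 - prob_error_le n c (partition_alg (nat \<lfloor>ln (real n)\<rfloor>) n) ((sqrt (real n) * ln (real n) ^ 4) powr (c + 1)))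
      \<le> 18 * norm (ln (real n) / real n ^ 2)"
  proof eventually_elim
    case (elim n)
    define r where "r = nat \<lfloor>ln (real n)\<rfloor>"
    have "1 \<le> r" using elim(1) unfolding admissible_def Let_def r_def by linarith
    then interpret admissible_instance n r using elim(1) by unfold_locales
    have r: "real r \<le> l" "l \<le> 4 * real r + 2" using ln_large unfolding r_def by linarith+
    define s where "s = 3 * l"
    have "b = 8 * (sqrt (real n) * exp (l / (4 * real r + 2)) * real r)" unfolding scale_ge by simp
    also have "\<dots> \<le> 8 * (sqrt (real n) * 3 * l)"
    proof -
      have "l / (4 * real r + 2) \<le> 1" using r by simp
      then have "exp (l / (4 * real r + 2)) \<le> exp 1" unfolding exp_le_cancel_iff .
      then have "exp (l / (4 * real r + 2)) \<le> 3" using exp_le by linarith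
      then show ?thesis using r by (intro mult_left_mono mult_mono) auto
    qed
    finally have "1540\<^sup>2 * s * l * b \<le> 1540\<^sup>2 * s * l * (8 * (sqrt (real n) * 3 * l))"
      using ln_large by (intro mult_left_mono) (auto simp: s_def)
    also have "\<dots> = 72 * 1540\<^sup>2 * l ^ 3 * sqrt (real n)" by (simp add: s_def power3_eq_cube)
    finally have "1540\<^sup>2 * s * l * b + 1 \<le> sqrt (real n) * l ^ 4" using elim(2) by linarith
    moreover have "0 \<le> 1540\<^sup>2 * s * l * b" using ln_large scale_large by (simp add: s_def)
    ultimately have "(1540\<^sup>2 * s * l * b + 1) powr (c + 1) \<le> (sqrt (real n) * l ^ 4) powr (c + 1)"
      using c by (intro powr_mono2) auto
    from prob_error_ge[OF this c] have
      "1 - 18 * real R * exp (- s) \<le> prob_error_le n c (partition_alg r n) ((sqrt (real n) * l ^ 4) powr (c + 1))"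
      using prob_coarse[of s] ln_large by (simp add: s_def)
    moreover have "18 * real R * exp (- s) \<le> 18 * (l / real n ^ 2)"
    proof -
      have "exp (- s) = 1 / real n ^ 3"
        using exp_of_nat_mult[of 3 l] exp_l by (simp add: s_def exp_minus divide_inverse)
      also have "\<dots> \<le> 1 / real n ^ 2"
        using n_large by (intro divide_left_mono power_increasing) auto
      finally have "real R * exp (- s) \<le> l * (1 / real n ^ 2)" using R(2) by (intro mult_mono) auto
      then show ?thesis by simp
    qed
    moreover have "prob_error_le n c (partition_alg r n) ((sqrt (real n) * l ^ 4) powr (c + 1)) \<le> 1"
      by (simp add: prob_error_le_def)
    ultimately show ?case using ln_large unfolding r_def by simp
  qed
qed

theorem theorem5:
  "\<exists>alg :: nat \<Rightarrow> nat \<Rightarrow> randomized_algorithm.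
     (\<forall>r\<ge>1. \<forall>n. partition_algorithm n 2 ((real r + 1) * real n) (alg r n)) \<and>
     (\<exists>\<delta>>0. \<forall>c\<ge>0. \<forall>\<^sub>F n in sequentially. \<forall>r\<ge>1. \<forall>\<epsilon>>0.
        expected_error n c (alg r n) \<le> error_bound n c r \<epsilon> \<and>
        prob_error_le n c (alg r n) (error_bound n c r \<epsilon>)
          \<ge> 1 - real r * exp (- (real n powr (\<delta> * \<epsilon>)))) \<and>
     (\<forall>n\<ge>3. partition_algorithm n 2 (real n * ln (real n) + real n)
                (alg (nat \<lfloor>ln (real n)\<rfloor>) n)) \<and>
     (\<forall>c\<ge>0. \<exists>B \<in> O(\<lambda>n. (sqrt (real n) * ln (real n) ^ 4) powr (c + 1)).
        (\<lambda>n. 1 - prob_error_le n c (alg (nat \<lfloor>ln (real n)\<rfloor>) n) (B n))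
          \<in> O(\<lambda>n. ln (real n) / real n ^ 2))"
proof (intro exI[of _ partition_alg] conjI allI impI)
  show "partition_algorithm n 2 ((real r + 1) * real n) (partition_alg r n)" for r n
    by (rule partition_algorithm_partition_alg)
  show "\<exists>\<delta>>0. \<forall>c\<ge>0. \<forall>\<^sub>F n in sequentially. \<forall>r\<ge>1. \<forall>\<epsilon>>0.
        expected_error n c (partition_alg r n) \<le> error_bound n c r \<epsilon> \<and>
        prob_error_le n c (partition_alg r n) (error_bound n c r \<epsilon>)
          \<ge> 1 - real r * exp (- (real n powr (\<delta> * \<epsilon>)))"
  \<comment> \<open>The constant comes from \<open>prob_error_bound\<close> and depends neither on
    \<open>c\<close> nor on \<open>r\<close> or \<epsilon>.\<close>
  proof (intro exI[of _ "1 / 34"] conjI allI impI)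
    fix c :: real assume c: "0 \<le> c"
    show "\<forall>\<^sub>F n in sequentially. \<forall>r\<ge>1. \<forall>\<epsilon>>0.
        expected_error n c (partition_alg r n) \<le> error_bound n c r \<epsilon> \<and>
        prob_error_le n c (partition_alg r n) (error_bound n c r \<epsilon>)
          \<ge> 1 - real r * exp (- (real n powr ((1 / 34) * \<epsilon>)))"
      using expected_error_bound[OF c] prob_error_bound by eventually_elim (use c in blast)
  qed simp
  show "partition_algorithm n 2 (real n * ln (real n) + real n) (partition_alg (nat \<lfloor>ln (real n)\<rfloor>) n)"
    if "3 \<le> n" for n
  proof (rule partition_algorithm_mono[OF partition_algorithm_partition_alg])
    have "real (nat \<lfloor>ln (real n)\<rfloor>) \<le> ln (real n)" using that by (simp add: ln_ge_zero)
    then have "(real (nat \<lfloor>ln (real n)\<rfloor>) + 1) * real n \<le> (ln (real n) + 1) * real n"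
      by (intro mult_right_mono) auto
    then show "(real (nat \<lfloor>ln (real n)\<rfloor>) + 1) * real n \<le> real n * ln (real n) + real n"
      by (simp add: algebra_simps)
  qed
  show "\<exists>B \<in> O(\<lambda>n. (sqrt (real n) * ln (real n) ^ 4) powr (c + 1)).
        (\<lambda>n. 1 - prob_error_le n c (partition_alg (nat \<lfloor>ln (real n)\<rfloor>) n) (B n))
          \<in> O(\<lambda>n. ln (real n) / real n ^ 2)" if "0 \<le> c" for c
    by (rule bexI[where x = "\<lambda>n. (sqrt (real n) * ln (real n) ^ 4) powr (c + 1)"])
      (use prob_error_log_rounds[OF that] in simp_all)
qed

end
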